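(* Let $n\ge1$, let $\mathcal{Z}=\{z_1,\dots,z_m\}\subset\mathbb{D}^n$ be $m$ distinct points and $w_1,\dots,w_m\in\mathbb{D}$. Let $\mathcal{Q}_{\mathcal{Z}}=\operatorname{span}\{\mathbb{S}(\cdot,z_i):i=1,\dots,m\}\subseteq H^2(\mathbb{T}^n)$, let $X_{\mathcal{Z},\mathcal{W}}\in\mathcal{B}(\mathcal{Q}_{\mathcal{Z}})$ be defined by $X_{\mathcal{Z},\mathcal{W}}^*\mathbb{S}(\cdot,z_j)=\bar w_j\mathbb{S}(\cdot,z_j)$ for $j=1,\dots,m$, let $\psi=X_{\mathcal{Z},\mathcal{W}}(P_{\mathcal{Q}_{\mathcal{Z}}}1)$ and \[ \tilde{\mathcal{M}}_{\mathcal{Q}_{\mathcal{Z}}}=(\mathcal{Q}_{\mathcal{Z}}^{conj}\ominus\{\bar\psi\})+\mathcal{M}_n+H^2_0(\mathbb{T}^n)\subseteq L^1(\mathbb{T}^n). \] Then there exists $\varphi\in\mathcal{S}(\mathbb{D}^n)$ with $\varphi(z_i)=w_i$ for all $i$ if and only if \[ \operatorname{dist}_{L^1(\mathbb{T}^n)}\Big(\frac{\bar\psi}{\|\psi\|_2^2},\tilde{\mathcal{M}}_{\mathcal{Q}_{\mathcal{Z}}}\Big)\ge1. \] Moreover, in this case $\psi(z_i)=w_i$ for all $i=1,\dots,m$.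
   Context: $\mu$ is normalized Lebesgue measure on $\mathbb{T}^n$; $\|\cdot\|_p$ the $L^p(\mathbb{T}^n,\mu)$ norm. $H^2(\mathbb{T}^n)$ is the closed subspace of $L^2(\mathbb{T}^n)$ of functions whose Fourier coefficients vanish off $\mathbb{Z}_+^n$, identified with analytic functions on $\mathbb{D}^n$. $\mathbb{S}(z,w)=\prod_{i=1}^n(1-z_i\bar w_i)^{-1}$ is the Szegő kernel and $\mathbb{S}(\cdot,w)(z)=\mathbb{S}(z,w)$. $P_{\mathcal{Q}_{\mathcal{Z}}}$ is the orthogonal projection of $H^2(\mathbb{T}^n)$ onto $\mathcal{Q}_{\mathcal{Z}}$. $\mathcal{S}(\mathbb{D}^n)$ is the closed unit ball of $H^\infty(\mathbb{D}^n)$. $S^{conj}=\{\bar f:f\in S\}$; $\mathcal{Q}_{\mathcal{Z}}^{conj}\ominus\{\bar\psi\}$ is the orthogonal complement of $\bar\psi$ in $\mathcal{Q}_{\mathcal{Z}}^{conj}$; $H^2_0(\mathbb{T}^n)=\{f\in H^2:f(0)=0\}$; $\mathcal{M}_n=L^2(\mathbb{T}^n)\ominus(H^2(\mathbb{T}^n)^{conj}+H^2(\mathbb{T}^n))$. $\operatorname{dist}_{L^1}(g,M)=\inf_{h\in M}\|g-h\|_1$.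
   Formalization: The formal theorem assumes ‖ψ‖₂ ≠ 0, which excludes only the case w_1 = … = w_m = 0 (where ψ = 0), since the quotient ψ̄/‖ψ‖₂² in the distance is then undefined. *)

theory Defs
  imports "HOL-Complex_Analysis.Complex_Analysis"
begin

text \<open>The torus T^n is parametrised by angles theta in [0,1]^n via
  theta |-> (exp(2 pi i theta_k))_k; normalized Lebesgue measure on T^n is the
  image of Lebesgue measure on the unit cube (which has volume 1).
  Functions on T^n are represented as functions of the angle vector.\<close>

definition tmeas :: "(real^'n::finite) measure" where
  "tmeas = lebesgue_on (cbox 0 One)"

definition tpt :: "real^'n::finite \<Rightarrow> complex^'n" where
  "tpt \<theta> = (\<chi> k. cis (2 * pi * (\<theta> $ k)))"

definition polydisc :: "(complex^'n::finite) set" where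
  "polydisc = {z. \<forall>k. cmod (z $ k) < 1}"

definition szego :: "complex^'n::finite \<Rightarrow> complex^'n \<Rightarrow> complex" where
  "szego z w = (\<Prod>k\<in>UNIV. inverse (1 - z $ k * cnj (w $ k)))"

definition szk :: "complex^'n::finite \<Rightarrow> real^'n \<Rightarrow> complex" where
  "szk w = (\<lambda>\<theta>. szego (tpt \<theta>) w)"

definition L2 :: "(real^'n::finite \<Rightarrow> complex) set" where
  "L2 = {f. f \<in> borel_measurable tmeas \<and> integrable tmeas (\<lambda>\<theta>. (cmod (f \<theta>))\<^sup>2)}"

definition linner :: "(real^'n::finite \<Rightarrow> complex) \<Rightarrow> (real^'n \<Rightarrow> complex) \<Rightarrow> complex" where
  "linner f g = integral\<^sup>L tmeas (\<lambda>\<theta>. f \<theta> * cnj (g \<theta>))"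

definition l2normsq :: "(real^'n::finite \<Rightarrow> complex) \<Rightarrow> real" where
  "l2normsq f = integral\<^sup>L tmeas (\<lambda>\<theta>. (cmod (f \<theta>))\<^sup>2)"

definition l1norm :: "(real^'n::finite \<Rightarrow> complex) \<Rightarrow> ennreal" where
  "l1norm f = (\<integral>\<^sup>+ \<theta>. ennreal (cmod (f \<theta>)) \<partial>tmeas)"

definition dist_L1 :: "(real^'n::finite \<Rightarrow> complex) \<Rightarrow> (real^'n \<Rightarrow> complex) set \<Rightarrow> ennreal" where
  "dist_L1 g M = (INF h\<in>M. l1norm (\<lambda>\<theta>. g \<theta> - h \<theta>))"

definition fourier :: "(real^'n::finite \<Rightarrow> complex) \<Rightarrow> ('n \<Rightarrow> int) \<Rightarrow> complex" where
  "fourier f \<alpha> = integral\<^sup>L tmeas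
     (\<lambda>\<theta>. f \<theta> * cis (- 2 * pi * (\<Sum>k\<in>UNIV. of_int (\<alpha> k) * \<theta> $ k)))"

definition H2 :: "(real^'n::finite \<Rightarrow> complex) set" where
  "H2 = {f \<in> L2. \<forall>\<alpha>. (\<exists>k. \<alpha> k < 0) \<longrightarrow> fourier f \<alpha> = 0}"

definition conjset :: "(real^'n::finite \<Rightarrow> complex) set \<Rightarrow> (real^'n \<Rightarrow> complex) set" where
  "conjset S = (\<lambda>f. \<lambda>\<theta>. cnj (f \<theta>)) ` S"

text \<open>Value at z in D^n of (the analytic extension of) f in H^2: f(z) = <f, S(.,z)>.\<close>
definition hval :: "(real^'n::finite \<Rightarrow> complex) \<Rightarrow> complex^'n \<Rightarrow> complex" where
  "hval f z = linner f (szk z)"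

definition H2_0 :: "(real^'n::finite \<Rightarrow> complex) set" where
  "H2_0 = {f \<in> H2. hval f 0 = 0}"

definition setsum :: "(real^'n::finite \<Rightarrow> complex) set \<Rightarrow> (real^'n \<Rightarrow> complex) set \<Rightarrow> (real^'n \<Rightarrow> complex) set" where
  "setsum A B = {(\<lambda>\<theta>. a \<theta> + b \<theta>) | a b. a \<in> A \<and> b \<in> B}"

definition Mn :: "(real^'n::finite \<Rightarrow> complex) set" where
  "Mn = {f \<in> L2. \<forall>g \<in> setsum (conjset H2) H2. linner f g = 0}"

definition QZ :: "nat \<Rightarrow> (nat \<Rightarrow> complex^'n::finite) \<Rightarrow> (real^'n \<Rightarrow> complex) set" where
  "QZ m z = {(\<lambda>\<theta>. \<Sum>i<m. c i * szk (z i) \<theta>) | c. True}"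

definition ominus1 :: "(real^'n::finite \<Rightarrow> complex) set \<Rightarrow> (real^'n \<Rightarrow> complex) \<Rightarrow> (real^'n \<Rightarrow> complex) set" where
  "ominus1 S v = {f \<in> S. linner f v = 0}"

text \<open>Holomorphic functions on the polydisc: continuous and holomorphic in each
  variable separately (Osgood's definition).\<close>
definition holo_polydisc :: "(complex^'n::finite \<Rightarrow> complex) \<Rightarrow> bool" where
  "holo_polydisc \<phi> \<longleftrightarrow> continuous_on polydisc \<phi> \<and>
     (\<forall>z\<in>polydisc. \<forall>k. (\<lambda>\<zeta>. \<phi> (\<chi> j. if j = k then \<zeta> else z $ j)) holomorphic_on ball 0 1)"

definition schur_class :: "(complex^'n::finite \<Rightarrow> complex) set" where
  "schur_class = {\<phi>. holo_polydisc \<phi> \<and> (\<forall>z\<in>polydisc. cmod (\<phi> z) \<le> 1)}"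

end

theory Submission
  imports Defs
begin

text \<open>
  If \<open>\<phi>\<close> interpolates, pair its dilation \<open>\<phi>(r\<cdot>)\<close>, a uniform limit of polynomials, with \<open>g - h\<close>, where
  \<open>g\<close> is the normalized conjugate of \<open>\<psi>\<close> and \<open>h\<close> is in the given subspace. The parts of \<open>h\<close> in \<open>M\<^sub>n\<close>
  and \<open>H\<^sup>2\<^sub>0\<close> contribute nothing, and as \<open>r\<close> tends to 1 the pairing tends to 1, while it is bounded by the
  \<open>L\<^sup>1\<close> norm of \<open>g - h\<close>.

  Conversely, the Hahn-Banach theorem gives a contractive functional \<open>\<Lambda>\<close> on \<open>L\<^sup>1\<close> that vanishes on the subspace
  and takes the value 1 at \<open>g\<close>. The interpolant is \<open>\<Phi>(z) = \<Lambda>(cnj S(\<cdot>, z))\<close>. It is holomorphic in \<open>z\<close>, and it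
  is bounded by 1 because the conjugate Szego kernel differs from the Poisson kernel, which is positive with integral 1,
  by a uniform limit of characters in \<open>M\<^sub>n\<close> and \<open>H\<^sup>2\<^sub>0\<close>. Neither the duality of \<open>L\<^sup>1\<close> and \<open>L\<^sup>\<infinity>\<close> nor boundary
  values of bounded holomorphic functions are needed.
\<close>

text \<open>The bridge between the data and the subspace is that \<open>X q\<close> represents
  interpolation on \<open>QZ m z\<close>: its inner product with \<open>szk (z j)\<close> is
  \<open>w j\<close>. Formally, an interpolant integrated against the conjugate of f = sum of d j *
  \<open>szk (z j)\<close> gives the sum of cnj (d j) * \<open>w j\<close>, which is also
  \<open>linner (X q) f\<close>. So conjugates of functions orthogonal to \<open>X q\<close>
  integrate to 0 and the normalized conjugate of \<open>X q\<close> to 1; this is the origin of the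
  factor 1 / \<open>l2normsq (X q)\<close> and of the threshold 1. Read backwards, a functional with
  these two properties has no freedom on the conjugates of \<open>QZ m z\<close> and sends the
  conjugate of \<open>szk (z i)\<close> to \<open>w i\<close>. The space \<open>Mn\<close> is the
  price of several variables. The conjugate Szego kernel has only frequencies with all coordinates
  nonpositive, the Poisson kernel has all frequencies. A surplus frequency either is nonnegative and
  nonzero, which \<open>H2_0\<close> covers, or has coordinates of both signs, which
  \<open>Mn\<close> covers. Once both kinds are annihilated, the Poisson kernel, of norm 1, can
  replace the Szego kernel, whose norm may exceed 1.\<close>

no_notation fps_nth (infixl "$" 75)

section \<open>The Hahn-Banach theorem\<close>

text \<open>Homogeneity is asked for as an inequality only, which is what infima satisfy most
  directly; equality follows by scaling back with the inverse of c.\<close>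

definition sublinear :: "('a::real_vector \<Rightarrow> real) \<Rightarrow> bool" where
  "sublinear p \<longleftrightarrow> (\<forall>x y. p (x + y) \<le> p x + p y) \<and> (\<forall>c x. 0 \<le> c \<longrightarrow> p (c *\<^sub>R x) \<le> c * p x)"

lemma sublinearI:
  assumes "\<And>x y. p (x + y) \<le> p x + p y" "\<And>c x. 0 \<le> c \<Longrightarrow> p (c *\<^sub>R x) \<le> c * p x"
  shows "sublinear p"
  using assms by (simp add: sublinear_def)

lemma sublinear_add: "sublinear p \<Longrightarrow> p (x + y) \<le> p x + p y"
  and sublinear_scale: "sublinear p \<Longrightarrow> 0 \<le> c \<Longrightarrow> p (c *\<^sub>R x) \<le> c * p x"
  by (simp_all add: sublinear_def)

lemma sublinear_zero: 
  assumes "sublinear p" shows "p 0 = 0"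
  using sublinear_add[OF assms, of 0 0] sublinear_scale[OF assms, of 0 0] by simp

lemma sublinear_minus:
  assumes "sublinear p" shows "- p (- x) \<le> p x"
  using sublinear_add[OF assms, of x "- x"] sublinear_zero[OF assms] by simp

lemma sublinear_scale_eq:
  assumes "sublinear p" "0 \<le> c"
  shows "p (c *\<^sub>R x) = c * p x"
proof (cases "c = 0")
  case True
  then show ?thesis using sublinear_zero[OF assms(1)] by simp
next
  case False
  with assms(2) have "c > 0" by simp
  then have "p (inverse c *\<^sub>R (c *\<^sub>R x)) \<le> inverse c * p (c *\<^sub>R x)"
    by (intro sublinear_scale[OF assms(1)]) simp
  then have "p x \<le> inverse c * p (c *\<^sub>R x)" using \<open>c > 0\<close> by simp
  then have "c * p x \<le> p (c *\<^sub>R x)" using \<open>c > 0\<close> by (simp add: field_simps)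
  then show ?thesis using sublinear_scale[OF assms, of x] by simp
qed

text \<open>This functional lies below \<open>p\<close> and is at most \<open>- p y\<close> at \<open>- y\<close>; minimality of \<open>p\<close> therefore forces linearity.\<close>

definition sublinear_ray :: "('a::real_vector \<Rightarrow> real) \<Rightarrow> 'a \<Rightarrow> 'a \<Rightarrow> real" where
  "sublinear_ray p y x = (INF t\<in>{0..}. p (x + t *\<^sub>R y) - t * p y)"

lemma sublinear_ray_le:
  assumes "sublinear p" "0 \<le> t"
  shows "sublinear_ray p y x \<le> p (x + t *\<^sub>R y) - t * p y"
  unfolding sublinear_ray_def
proof (rule cINF_lower)
  \<comment> \<open>Subadditivity for t y = (x + t y) + (- x) gives a lower bound that does not
    depend on t, so the infimum is a genuine one.\<close>
  show "bdd_below ((\<lambda>t. p (x + t *\<^sub>R y) - t * p y) ` {0..})"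
  proof (rule bdd_belowI2)
    fix t :: real assume "t \<in> {0..}"
    then have "t * p y \<le> p ((x + t *\<^sub>R y) + (- x))"
      using sublinear_scale_eq[OF assms(1), of t y] by simp
    also have "\<dots> \<le> p (x + t *\<^sub>R y) + p (- x)" by (rule sublinear_add[OF assms(1)])
    finally show "- p (- x) \<le> p (x + t *\<^sub>R y) - t * p y" by simp
  qed
qed (use assms in simp)

lemma sublinear_ray_greatest:
  assumes "\<And>t. 0 \<le> t \<Longrightarrow> b \<le> p (x + t *\<^sub>R y) - t * p y"
  shows "b \<le> sublinear_ray p y x"
  unfolding sublinear_ray_def by (rule cINF_greatest) (use assms in auto)

lemma sublinear_ray_le_self:
  assumes "sublinear p" shows "sublinear_ray p y x \<le> p x"
  using sublinear_ray_le[OF assms, of 0 y x] by simp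

lemma sublinear_sublinear_ray:
  assumes p: "sublinear p"
  shows "sublinear (sublinear_ray p y)"
proof (rule sublinearI)
  fix u v
  have *: "sublinear_ray p y (u + v) \<le> (p (u + s *\<^sub>R y) - s * p y) + (p (v + t *\<^sub>R y) - t * p y)"
    if "0 \<le> s" "0 \<le> t" for s t
  proof -
    have "sublinear_ray p y (u + v) \<le> p ((u + v) + (s + t) *\<^sub>R y) - (s + t) * p y"
      using that by (intro sublinear_ray_le p) simp
    also have "(u + v) + (s + t) *\<^sub>R y = (u + s *\<^sub>R y) + (v + t *\<^sub>R y)"
      by (simp add: algebra_simps)
    finally show ?thesis
      using sublinear_add[OF p, of "u + s *\<^sub>R y" "v + t *\<^sub>R y"] by (simp add: algebra_simps)
  qed
  have "sublinear_ray p y (u + v) - (p (v + t *\<^sub>R y) - t * p y) \<le> sublinear_ray p y u"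
    if "0 \<le> t" for t
    by (rule sublinear_ray_greatest) (use *[OF _ that] in \<open>simp add: algebra_simps\<close>)
  then have "sublinear_ray p y (u + v) - sublinear_ray p y u \<le> sublinear_ray p y v"
    by (intro sublinear_ray_greatest) (simp add: algebra_simps)
  then show "sublinear_ray p y (u + v) \<le> sublinear_ray p y u + sublinear_ray p y v" by simp
next
  fix c :: real and x assume c: "0 \<le> c"
  show "sublinear_ray p y (c *\<^sub>R x) \<le> c * sublinear_ray p y x"
  proof (cases "c = 0")
    case True
    then show ?thesis using sublinear_ray_le_self[OF p, of y 0] sublinear_zero[OF p] by simp
  next
    case False
    with c have c: "c > 0" by simp
    have "sublinear_ray p y (c *\<^sub>R x) / c \<le> sublinear_ray p y x"
    proof (rule sublinear_ray_greatest)
      fix t :: real assume "0 \<le> t"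
      then have "sublinear_ray p y (c *\<^sub>R x) \<le> p (c *\<^sub>R x + (c * t) *\<^sub>R y) - (c * t) * p y"
        using c by (intro sublinear_ray_le p) simp
      also have "c *\<^sub>R x + (c * t) *\<^sub>R y = c *\<^sub>R (x + t *\<^sub>R y)" by (simp add: algebra_simps)
      also have "p \<dots> = c * p (x + t *\<^sub>R y)" using c by (intro sublinear_scale_eq p) simp
      finally show "sublinear_ray p y (c *\<^sub>R x) / c \<le> p (x + t *\<^sub>R y) - t * p y"
        using c by (simp add: field_simps)
    qed
    then show ?thesis using c by (simp add: field_simps)
  qed
qed

text \<open>The common lower bound - p (- x) keeps the pointwise infimum finite. The chain condition
  enters in subadditivity: two members, one nearly optimal at x and one at y, are replaced by the
  smaller of the two.\<close>

lemma sublinear_chain_INF: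
  fixes p :: "'a::real_vector \<Rightarrow> real"
  assumes "C \<noteq> {}" and all: "\<forall>s\<in>C. sublinear s \<and> (\<forall>x. s x \<le> p x)"
    and chain: "\<forall>s\<in>C. \<forall>t\<in>C. (\<forall>x. s x \<le> t x) \<or> (\<forall>x. t x \<le> s x)"
  shows "sublinear (\<lambda>x. INF s\<in>C. s x)" and "\<And>s x. s \<in> C \<Longrightarrow> (INF s\<in>C. s x) \<le> s x"
proof -
  define u where "u = (\<lambda>x. INF s\<in>C. s x)"
  have C: "sublinear s \<and> (\<forall>x. s x \<le> p x)" if "s \<in> C" for s using all that by blast
  have bdd: "bdd_below ((\<lambda>s. s x) ` C)" for x
  proof (rule bdd_belowI2)
    fix s assume "s \<in> C"
    then have "s (- x) \<le> p (- x)" "- s (- x) \<le> s x"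
      using C[of s] sublinear_minus[of s x] by auto
    then show "- p (- x) \<le> s x" by linarith
  qed
  have le: "u x \<le> s x" if "s \<in> C" for s x
    unfolding u_def using bdd that by (rule cINF_lower)
  then show "\<And>s x. s \<in> C \<Longrightarrow> (INF s\<in>C. s x) \<le> s x" by (simp add: u_def)
  have gr: "b \<le> u x" if "\<And>s. s \<in> C \<Longrightarrow> b \<le> s x" for b x
    unfolding u_def using assms(1) that by (rule cINF_greatest)
  have "sublinear u"
  proof (rule sublinearI)
    fix x y
    have *: "u (x + y) \<le> s x + t y" if st: "s \<in> C" "t \<in> C" for s t
    proof -
      obtain r where r: "r \<in> C" "r x \<le> s x" "r y \<le> t y"
        using chain st by blast
      have "u (x + y) \<le> r (x + y)" by (rule le[OF r(1)])
      also have "\<dots> \<le> r x + r y" using C[OF r(1)] by (auto intro: sublinear_add)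
      finally show ?thesis using r by simp
    qed
    have "u (x + y) - t y \<le> u x" if "t \<in> C" for t
      by (rule gr) (use *[OF _ that] in \<open>simp add: algebra_simps\<close>)
    then have "u (x + y) - u x \<le> u y"
      by (intro gr) (simp add: algebra_simps)
    then show "u (x + y) \<le> u x + u y" by simp
  next
    fix c :: real and x assume c: "0 \<le> c"
    show "u (c *\<^sub>R x) \<le> c * u x"
    proof (cases "c = 0")
      case True
      obtain s where "s \<in> C" using assms(1) by auto
      then show ?thesis using True le[of s 0] C[of s] sublinear_zero[of s] by auto
    next
      case False
      with c have c: "c > 0" by simp
      have "u (c *\<^sub>R x) / c \<le> u x"
      proof (rule gr)
        fix s assume s: "s \<in> C"
        have "u (c *\<^sub>R x) \<le> c * s x"
          using le[OF s, of "c *\<^sub>R x"] sublinear_scale[of s c x] C[OF s] c by auto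
        then show "u (c *\<^sub>R x) / c \<le> s x" using c by (simp add: field_simps)
      qed
      then show ?thesis using c by (simp add: field_simps)
    qed
  qed
  then show "sublinear (\<lambda>x. INF s\<in>C. s x)" by (simp add: u_def)
qed

lemma exists_minimal_sublinear:
  fixes p :: "'a::real_vector \<Rightarrow> real"
  assumes "sublinear p"
  shows "\<exists>s. sublinear s \<and> (\<forall>x. s x \<le> p x) \<and> (\<forall>t. sublinear t \<longrightarrow> (\<forall>x. t x \<le> s x) \<longrightarrow> t = s)"
proof -
  define A where "A = {s. sublinear s \<and> (\<forall>x. s x \<le> p x)}"
  \<comment> \<open>The order is reversed, so that a maximal element in the sense of Zorn's lemma is
    a pointwise minimal functional.\<close>
  define P where "P = (\<lambda>(a :: 'a \<Rightarrow> real) b. \<forall>x. b x \<le> a x)"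
  have "\<exists>m\<in>A. \<forall>a\<in>A. P m a \<longrightarrow> a = m"
  proof (rule predicate_Zorn)
    show "partial_order_on A (relation_of P A)"
    proof (rule partial_order_on_relation_ofI)
      show "a = b" if "P a b" "P b a" for a b
        using that by (intro ext antisym) (auto simp: P_def)
      show "P a c" if "P a b" "P b c" for a b c
      proof -
        have "c x \<le> a x" for x using that order_trans[of "c x" "b x" "a x"] by (simp add: P_def)
        then show ?thesis by (simp add: P_def)
      qed
    qed (simp add: P_def)
    fix C assume C: "C \<in> Chains (relation_of P A)"
    show "\<exists>u\<in>A. \<forall>a\<in>C. P a u"
    proof (cases "C = {}")
      case True
      then show ?thesis using assms by (auto simp: A_def)
    next
      case False
      have CA: "\<forall>s\<in>C. sublinear s \<and> (\<forall>x. s x \<le> p x)"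
        using C by (auto simp: Chains_def relation_of_def A_def)
      have ch: "\<forall>s\<in>C. \<forall>t\<in>C. (\<forall>x. s x \<le> t x) \<or> (\<forall>x. t x \<le> s x)"
        using C by (auto simp: Chains_def relation_of_def P_def)
      note u = sublinear_chain_INF[OF False CA ch]
      obtain s where s: "s \<in> C" using False by auto
      have "(INF s\<in>C. s x) \<le> p x" for x
        by (rule order_trans[OF u(2)[OF s]]) (use CA s in blast)
      then show ?thesis
        using u by (intro bexI[of _ "\<lambda>x. INF s\<in>C. s x"]) (auto simp: A_def P_def)
    qed
  qed
  then obtain s where s: "s \<in> A" "\<And>a. a \<in> A \<Longrightarrow> P s a \<Longrightarrow> a = s" by blast
  show ?thesis
  proof (intro exI[of _ s] conjI allI impI)
    fix t assume t: "sublinear t" "\<forall>x. t x \<le> s x"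
    have "t x \<le> p x" for x
      using s(1) t order_trans[of "t x" "s x" "p x"] by (simp add: A_def)
    with t show "t = s" by (intro s(2)) (simp_all add: A_def P_def)
  qed (use s in \<open>auto simp: A_def\<close>)
qed

text \<open>Minimality gives \<open>sublinear_ray s y = s\<close> for every y, and the term t = 1 of
  that infimum is the reverse of subadditivity.\<close>

lemma linear_if_minimal_sublinear:
  fixes s :: "'a::real_vector \<Rightarrow> real"
  assumes s: "sublinear s" and min: "\<And>t. sublinear t \<Longrightarrow> \<forall>x. t x \<le> s x \<Longrightarrow> t = s"
  shows "linear s"
proof -
  have "s x \<le> s (x + y) - s y" for x y
    using min[OF sublinear_sublinear_ray[OF s, of y]] sublinear_ray_le_self[OF s]
      sublinear_ray_le[OF s, of 1 y x] by simp
  then have add: "s (x + y) = s x + s y" for x y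
    using sublinear_add[OF s, of x y] by (simp add: algebra_simps antisym)
  have neg: "s (- x) = - s x" for x
    using add[of x "- x"] sublinear_zero[OF s] by simp
  have "s (c *\<^sub>R x) = c * s x" for c x
  proof (cases "0 \<le> c")
    case True
    then show ?thesis by (rule sublinear_scale_eq[OF s])
  next
    case False
    then have "s ((- c) *\<^sub>R x) = (- c) * s x" by (intro sublinear_scale_eq[OF s]) simp
    then show ?thesis using neg[of "c *\<^sub>R x"] by simp
  qed
  with add show ?thesis by (intro linearI) auto
qed

text \<open>No functional is extended from the line through \<open>x0\<close>. Instead the minimal
  functional is taken below \<open>sublinear_ray p x0\<close>, whose term t = 1 at -
  \<open>x0\<close> forces the value \<open>p x0\<close> once the functional is linear.\<close>

theorem hahn_banach_attained:
  fixes p :: "'a::real_vector \<Rightarrow> real"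
  assumes p: "sublinear p"
  obtains f where "linear f" "\<And>x. f x \<le> p x" "f x0 = p x0"
proof -
  obtain s where s: "sublinear s" "\<forall>x. s x \<le> sublinear_ray p x0 x"
    "\<forall>t. sublinear t \<longrightarrow> (\<forall>x. t x \<le> s x) \<longrightarrow> t = s"
    using exists_minimal_sublinear[OF sublinear_sublinear_ray[OF p, of x0]] by (elim exE conjE)
  have lin: "linear s" using s(1,3) by (simp add: linear_if_minimal_sublinear)
  have le: "s x \<le> p x" for x
    using s(2)[rule_format, of x] sublinear_ray_le_self[OF p, of x0 x] by simp
  have "s (- x0) \<le> - p x0"
    using s(2)[rule_format, of "- x0"] sublinear_ray_le[OF p, of 1 x0 "- x0"] sublinear_zero[OF p] by simp
  then have "s x0 = p x0"
    using le[of x0] linear_neg[OF lin, of x0] by simp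
  with lin le show ?thesis by (rule that)
qed

section \<open>Polynomial approximation on polydiscs\<close>

definition cpolydisc :: "(complex^'n::finite) set" where
  "cpolydisc = {z. \<forall>k. cmod (z $ k) \<le> 1}"

text \<open>Sums of monomials, with no closure under products: the later inductions concern
  integrals linear in the polynomial, and a monomial on the torus is a character.\<close>

inductive polyfun :: "(complex^'n::finite \<Rightarrow> complex) \<Rightarrow> bool" where
  monom: "polyfun (\<lambda>z. c * (\<Prod>k\<in>UNIV. (z $ k) ^ \<alpha> k))"
| add: "polyfun f \<Longrightarrow> polyfun g \<Longrightarrow> polyfun (\<lambda>z. f z + g z)"

lemma polyfun_const: "polyfun (\<lambda>z. c)"
  using polyfun.monom[of c "\<lambda>_. 0"] by simp

lemma polyfun_cmult: "polyfun f \<Longrightarrow> polyfun (\<lambda>z. c * f z)"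
proof (induction rule: polyfun.induct)
  case (monom d \<alpha>)
  then show ?case using polyfun.monom[of "c * d" \<alpha>] by (simp add: mult.assoc)
next
  case (add f g)
  then show ?case using polyfun.add by (simp add: distrib_left)
qed

lemma polyfun_mult_coord: "polyfun f \<Longrightarrow> polyfun (\<lambda>z. f z * (z $ k) ^ j)"
proof (induction rule: polyfun.induct)
  case (monom c \<alpha>)
  have "(\<Prod>i\<in>UNIV. (z $ i) ^ (\<alpha>(k := \<alpha> k + j)) i)
      = (\<Prod>i\<in>UNIV. (z $ i) ^ \<alpha> i * (if i = k then (z $ k) ^ j else 1))" for z :: "complex^'a"
    by (intro prod.cong) (auto simp: power_add)
  then have "(\<Prod>i\<in>UNIV. (z $ i) ^ (\<alpha>(k := \<alpha> k + j)) i) = (\<Prod>i\<in>UNIV. (z $ i) ^ \<alpha> i) * (z $ k) ^ j"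
    for z :: "complex^'a"
    by (simp add: prod.distrib)
  then show ?case using polyfun.monom[of c "\<alpha>(k := \<alpha> k + j)"] by (simp add: mult.assoc)
next
  case (add f g)
  then show ?case using polyfun.add by (simp add: distrib_right)
qed

lemma polyfun_sum: "finite A \<Longrightarrow> (\<And>a. a \<in> A \<Longrightarrow> polyfun (f a)) \<Longrightarrow> polyfun (\<lambda>z. \<Sum>a\<in>A. f a z)"
  by (induction A rule: finite_induct) (auto intro: polyfun_const polyfun.add)

section \<open>Interpolation in one variable at the roots of unity\<close>

definition unity_node :: "nat \<Rightarrow> nat \<Rightarrow> complex" where
  "unity_node N l = cis (2 * pi * real l / real N)"

lemma norm_unity_node [simp]: "cmod (unity_node N l) = 1"
  by (simp add: unity_node_def)

lemma unity_node_orthogonal: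
  assumes "i < N" "j < N"
  shows "(\<Sum>l<N. unity_node N l ^ i * cnj (unity_node N l) ^ j) = (if i = j then of_nat N else 0)"
proof -
  \<comment> \<open>\<open>u\<close> is the root of unity with exponent i - j. As exponent and index
    of a node can be exchanged, the sum becomes a geometric series in \<open>u\<close>.\<close>
  define u where "u = unity_node N i * cnj (unity_node N j)"
  have N: "N > 0" using assms by simp
  have pow: "unity_node N l ^ i = unity_node N i ^ l" for l i
    by (simp only: unity_node_def Complex.DeMoivre) (simp add: mult_ac)
  have "(\<Sum>l<N. unity_node N l ^ i * cnj (unity_node N l) ^ j) = (\<Sum>l<N. u ^ l)"
    by (intro sum.cong refl)
       (simp add: u_def power_mult_distrib pow flip: complex_cnj_power)
  also have "\<dots> = (if i = j then of_nat N else 0)"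
  proof (cases "i = j")
    case True
    then have "u = 1" by (simp add: u_def complex_norm_square[symmetric])
    with True show ?thesis by simp
  next
    case False
    have "unity_node N i ^ N = 1" for i
      using N by (simp add: unity_node_def Complex.DeMoivre)
    then have uN: "u ^ N = 1"
      by (simp add: u_def power_mult_distrib flip: complex_cnj_power)
    have "u \<noteq> 1"
    proof
      assume "u = 1"
      then have "unity_node N i * (cnj (unity_node N j) * unity_node N j) = unity_node N j"
        by (simp add: u_def mult_ac)
      moreover have "cnj (unity_node N j) * unity_node N j = 1"
        by (simp add: complex_norm_square[symmetric] mult.commute)
      ultimately have "unity_node N i = unity_node N j" by simp
      then show False
        using bij_betw_imp_inj_on[OF Complex.bij_betw_roots_unity[OF N]] assms False
        by (auto simp: unity_node_def inj_on_def)
    qed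
    then show ?thesis using False uN by (simp add: geometric_sum)
  qed
  finally show ?thesis .
qed

text \<open>The discrete Fourier transform of the samples: the coefficient of order j of the
  polynomial of degree below N that agrees with f at the N-th roots of unity.\<close>

definition interp_coeff :: "nat \<Rightarrow> (complex \<Rightarrow> complex) \<Rightarrow> nat \<Rightarrow> complex" where
  "interp_coeff N f j = (\<Sum>l<N. f (unity_node N l) * cnj (unity_node N l) ^ j) / of_nat N"

lemma interp_coeff_poly:
  assumes "j < N"
  shows "interp_coeff N (\<lambda>u. \<Sum>i<N. b i * u ^ i) j = b j"
proof -
  have "(\<Sum>l<N. (\<Sum>i<N. b i * unity_node N l ^ i) * cnj (unity_node N l) ^ j)
      = (\<Sum>i<N. b i * (\<Sum>l<N. unity_node N l ^ i * cnj (unity_node N l) ^ j))"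
    unfolding sum_distrib_right sum_distrib_left by (subst sum.swap) (simp add: mult_ac)
  also have "\<dots> = (\<Sum>i<N. if i = j then b i * of_nat N else 0)"
    using assms by (intro sum.cong) (auto simp: unity_node_orthogonal)
  also have "\<dots> = b j * of_nat N" using assms by simp
  finally show ?thesis using assms by (simp add: interp_coeff_def)
qed

lemma norm_interp_coeff_le:
  assumes "\<And>l. l < N \<Longrightarrow> cmod (f (unity_node N l)) \<le> d" "0 \<le> d"
  shows "cmod (interp_coeff N f j) \<le> d"
proof (cases "N = 0")
  case True
  then show ?thesis using assms by (simp add: interp_coeff_def)
next
  case False
  have "cmod (\<Sum>l<N. f (unity_node N l) * cnj (unity_node N l) ^ j) \<le> of_nat (card {..<N}) * d"
    by (rule sum_norm_bound) (use assms in \<open>simp add: norm_mult norm_power\<close>)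
  then show ?thesis using False by (simp add: interp_coeff_def norm_divide field_simps)
qed

lemma interp_coeff_diff:
  "interp_coeff N f j - interp_coeff N g j = interp_coeff N (\<lambda>u. f u - g u) j"
  by (simp add: interp_coeff_def diff_divide_distrib left_diff_distrib sum_subtractf)

text \<open>Interpolation is exact on the Taylor truncation of degree below N, and each coefficient
  is an average of samples. Every coefficient therefore errs by at most the Taylor tail; N such
  errors and the tail itself produce the factor 1 + N, which the power of \<rho> outweighs.\<close>

lemma interpolation_error:
  assumes hol: "f holomorphic_on ball 0 1" and bd: "\<And>u. cmod u < 1 \<Longrightarrow> cmod (f u) \<le> C"
    and r: "0 \<le> r" "r < 1" and \<zeta>: "cmod \<zeta> \<le> 1"
  defines "\<rho> \<equiv> 2 * r / (1 + r)"
  shows "cmod (f (of_real r * \<zeta>) - (\<Sum>j<N. interp_coeff N (\<lambda>u. f (of_real r * u)) j * \<zeta> ^ j))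
    \<le> (1 + real N) * (C * \<rho> ^ N / (1 - \<rho>))"
proof -
  \<comment> \<open>Cauchy's inequality is applied on a radius strictly between r and 1. The
    midpoint makes the ratio r / s equal to \<rho>.\<close>
  define s where "s = (1 + r) / 2"
  have s: "0 < s" "s < 1" "r < s" using r by (auto simp: s_def)
  have \<rho>: "\<rho> = r / s" "0 \<le> \<rho>" "\<rho> < 1" using r by (auto simp: \<rho>_def s_def field_simps)
  have C: "0 \<le> C" using bd[of 0] norm_ge_zero[of "f 0"] by (simp del: norm_ge_zero) 
  define b where "b i = (deriv ^^ i) f 0 / fact i * of_real r ^ i" for i
  have bi: "cmod (b i) \<le> C * \<rho> ^ i" for i
  proof -
    have "cmod ((deriv ^^ i) f 0) \<le> fact i * C / s ^ i"
    proof (rule Cauchy_inequality)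
      show "f holomorphic_on ball 0 s" using hol by (rule holomorphic_on_subset) (use s in auto)
      show "continuous_on (cball 0 s) f"
        by (rule holomorphic_on_imp_continuous_on, rule holomorphic_on_subset[OF hol]) (use s in auto)
    qed (use s bd in \<open>auto\<close>)
    then have "cmod ((deriv ^^ i) f 0) / fact i \<le> C / s ^ i"
      by (simp add: field_simps)
    then have "cmod ((deriv ^^ i) f 0) / fact i * r ^ i \<le> C / s ^ i * r ^ i"
      using r by (intro mult_right_mono) auto
    then show ?thesis using r by (simp add: b_def norm_mult norm_divide norm_power \<rho>(1) power_divide)
  qed
  define T where "T u = (\<Sum>i<N. b i * u ^ i)" for u
  define d where "d = C * \<rho> ^ N / (1 - \<rho>)"
  have d0: "0 \<le> d" using C \<rho> by (simp add: d_def)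
  have tail: "cmod (f (of_real r * u) - T u) \<le> d" if u: "cmod u \<le> 1" for u
  proof -
    have "cmod (of_real r * u) < 1"
    proof -
      have "r * cmod u \<le> r * 1" using u r by (intro mult_left_mono) auto
      then show ?thesis using r by (simp add: norm_mult)
    qed
    then have "(\<lambda>n. (deriv ^^ n) f 0 / fact n * (of_real r * u - 0) ^ n) sums f (of_real r * u)"
      by (intro holomorphic_power_series[OF hol]) simp
    then have "(\<lambda>n. b n * u ^ n) sums f (of_real r * u)"
      by (simp add: b_def power_mult_distrib mult_ac)
    then have "(\<lambda>n. b (n + N) * u ^ (n + N)) sums (f (of_real r * u) - T u)"
      by (subst sums_iff_shift) (simp add: T_def)
    moreover have "(\<lambda>n. C * \<rho> ^ N * \<rho> ^ n) sums (C * \<rho> ^ N * (1 / (1 - \<rho>)))"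
      using \<rho> by (intro sums_mult geometric_sums) simp
    moreover have "cmod (b (n + N) * u ^ (n + N)) \<le> C * \<rho> ^ N * \<rho> ^ n" for n
    proof -
      have "cmod (b (n + N)) * cmod u ^ (n + N) \<le> (C * \<rho> ^ (n + N)) * 1"
        using u bi C \<rho> by (intro mult_mono power_le_one) auto
      then show ?thesis by (simp add: norm_mult norm_power power_add mult_ac)
    qed
    ultimately have "cmod (f (of_real r * u) - T u) \<le> C * \<rho> ^ N * (1 / (1 - \<rho>))"
      by (rule norm_sums_le)
    then show ?thesis by (simp add: d_def)
  qed
  let ?I = "\<lambda>j. interp_coeff N (\<lambda>u. f (of_real r * u)) j"
  have Ib: "cmod (?I j - b j) \<le> d" if "j < N" for j
  proof -
    have "?I j - b j = interp_coeff N (\<lambda>u. f (of_real r * u) - T u) j"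
      using interp_coeff_poly[OF that, of b] by (simp add: T_def flip: interp_coeff_diff)
    also have "cmod \<dots> \<le> d" by (rule norm_interp_coeff_le) (use tail d0 in auto)
    finally show ?thesis .
  qed
  have "cmod (\<Sum>j<N. (?I j - b j) * \<zeta> ^ j) \<le> of_nat (card {..<N}) * d"
  proof (rule sum_norm_bound)
    fix j assume "j \<in> {..<N}"
    then have "cmod (?I j - b j) * cmod \<zeta> ^ j \<le> d * 1"
      using Ib[of j] \<zeta> d0 by (intro mult_mono power_le_one) auto
    then show "cmod ((?I j - b j) * \<zeta> ^ j) \<le> d" by (simp add: norm_mult norm_power)
  qed
  moreover have "f (of_real r * \<zeta>) - (\<Sum>j<N. ?I j * \<zeta> ^ j)
      = (f (of_real r * \<zeta>) - T \<zeta>) - (\<Sum>j<N. (?I j - b j) * \<zeta> ^ j)"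
    by (simp add: T_def left_diff_distrib sum_subtractf)
  ultimately have "cmod (f (of_real r * \<zeta>) - (\<Sum>j<N. ?I j * \<zeta> ^ j)) \<le> d + real N * d"
    using tail[OF \<zeta>] norm_triangle_ineq4[of "f (of_real r * \<zeta>) - T \<zeta>" "\<Sum>j<N. (?I j - b j) * \<zeta> ^ j"]
    by (simp only: card_lessThan)
  then show ?thesis by (simp add: d_def distrib_right add_divide_distrib)
qed

section \<open>Induction on the number of variables\<close>

definition vupd :: "complex^'n::finite \<Rightarrow> 'n \<Rightarrow> complex \<Rightarrow> complex^'n" where
  "vupd z k \<zeta> = (\<chi> j. if j = k then \<zeta> else z $ j)"

lemma vupd_nth: "vupd z k \<zeta> $ j = (if j = k then \<zeta> else z $ j)"
  by (simp add: vupd_def)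

lemma vupd_polydisc: "z \<in> polydisc \<Longrightarrow> cmod \<zeta> < 1 \<Longrightarrow> vupd z k \<zeta> \<in> polydisc"
  by (simp add: polydisc_def vupd_nth)

lemma holo_polydisc_vupd:
  assumes "holo_polydisc f" "cmod c < 1"
  shows "holo_polydisc (\<lambda>z. f (vupd z k c))"
  unfolding holo_polydisc_def
proof (intro conjI ballI allI)
  have f: "continuous_on polydisc f"
    "\<And>z k. z \<in> polydisc \<Longrightarrow> (\<lambda>\<zeta>. f (vupd z k \<zeta>)) holomorphic_on ball 0 1"
    using assms by (auto simp: holo_polydisc_def vupd_def)
  have "continuous_on polydisc (\<lambda>z. vupd z k c)"
    unfolding vupd_def
  proof (rule continuous_on_vec_lambda)
    show "continuous_on polydisc (\<lambda>z. if j = k then c else z $ j)" for j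
      by (cases "j = k") (auto intro!: continuous_intros)
  qed
  then show "continuous_on polydisc (\<lambda>z. f (vupd z k c))"
    by (rule continuous_on_compose2[OF f(1)]) (use vupd_polydisc assms(2) in blast)
  fix z :: "complex^'a" and i assume z: "z \<in> polydisc"
  have "(\<lambda>\<zeta>. f (vupd (vupd z i \<zeta>) k c)) holomorphic_on ball 0 1"
  proof (cases "i = k")
    case True
    then have "vupd (vupd z i \<zeta>) k c = vupd z k c" for \<zeta> by (simp add: vec_eq_iff vupd_nth)
    then show ?thesis by simp
  next
    case False
    then have "vupd (vupd z i \<zeta>) k c = vupd (vupd z k c) i \<zeta>" for \<zeta>
      by (auto simp: vec_eq_iff vupd_nth)
    then show ?thesis using f(2)[OF vupd_polydisc[OF z assms(2)], of k i] by simp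
  qed
  then show "(\<lambda>\<zeta>. f (vupd (\<chi> j. if j = i then \<zeta> else z $ j) k c)) holomorphic_on ball 0 1"
    by (simp add: vupd_def)
qed

lemma scaleR_cpolydisc:
  assumes "z \<in> cpolydisc" "0 \<le> r" "r < 1" shows "r *\<^sub>R z \<in> polydisc"
proof -
  have "r * cmod (z $ k) < 1" for k
    using mult_left_mono[of "cmod (z $ k)" 1 r] assms by (auto simp: cpolydisc_def)
  then show ?thesis using assms by (simp add: polydisc_def)
qed

text \<open>Interpolating at roots of unity, rather than truncating Taylor series, keeps the coefficients
  finite combinations of values of \<open>f\<close>, so that they are visibly holomorphic in the remaining variables.\<close>

lemma polyfun_approx_aux:
  fixes f :: "complex^'n::finite \<Rightarrow> complex"
  assumes "finite F" "holo_polydisc f" "\<And>z. z \<in> polydisc \<Longrightarrow> cmod (f z) \<le> C"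
    and "\<And>z w. z \<in> polydisc \<Longrightarrow> w \<in> polydisc \<Longrightarrow> \<forall>k\<in>F. z $ k = w $ k \<Longrightarrow> f z = f w"
    and r: "0 \<le> r" "r < 1" and "0 < \<epsilon>"
  shows "\<exists>p. polyfun p \<and> (\<forall>z\<in>cpolydisc. cmod (f (r *\<^sub>R z) - p z) < \<epsilon>)"
  using assms(1,2,3,4,7)
proof (induction F arbitrary: f \<epsilon> rule: finite_induct)
  case empty
  have "f (r *\<^sub>R z) = f 0" if "z \<in> cpolydisc" for z
    using empty.prems(3)[of "r *\<^sub>R z" 0] scaleR_cpolydisc[OF that r] by (simp add: polydisc_def)
  then show ?case using polyfun_const[of "f 0"] empty.prems(4) by (intro exI[of _ "\<lambda>_. f 0"]) simp
next
  case (insert k F)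
  define \<rho> where "\<rho> = 2 * r / (1 + r)"
  have \<rho>: "0 \<le> \<rho>" "\<rho> < 1" using r by (auto simp: \<rho>_def field_simps)
  have "(\<lambda>N. (1 + real N) * (C * \<rho> ^ N / (1 - \<rho>))) \<longlonglongrightarrow> 0"
  proof -
    have "(\<lambda>N. C / (1 - \<rho>) * (\<rho> ^ N + real N * \<rho> ^ N)) \<longlonglongrightarrow> C / (1 - \<rho>) * (0 + 0)"
      using \<rho> by (intro tendsto_intros LIMSEQ_power_zero powser_times_n_limit_0) auto
    then show ?thesis by (simp add: algebra_simps add_divide_distrib)
  qed
  then have "\<forall>\<^sub>F N in sequentially. (1 + real N) * (C * \<rho> ^ N / (1 - \<rho>)) < \<epsilon> / 2"
    using insert.prems(4) by (intro order_tendstoD) auto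
  then obtain N where N: "(1 + real N) * (C * \<rho> ^ N / (1 - \<rho>)) < \<epsilon> / 2" "N > 0"
    using eventually_happens[OF eventually_conj[OF _ eventually_gt_at_top[of 0]]] by auto
  \<comment> \<open>N coefficients are approximated, each multiplied by a power of modulus at most
    1, so errors of this size add up to half of \<epsilon>. The other half is the interpolation
    error.\<close>
  define \<delta> where "\<delta> = \<epsilon> / (2 * real N)"
  have \<delta>: "\<delta> > 0" using insert.prems(4) N by (simp add: \<delta>_def)
  define c where "c l = of_real r * unity_node N l" for l
  have c: "cmod (c l) < 1" for l using r by (simp add: c_def norm_mult)
  \<comment> \<open>With coordinate k frozen at a scaled node, the function depends on the
    coordinates in F only, so the induction hypothesis applies to each sample.\<close>
  have "\<exists>p. polyfun p \<and> (\<forall>z\<in>cpolydisc. cmod (f (vupd (r *\<^sub>R z) k (c l)) - p z) < \<delta>)" for l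
  proof (rule insert.IH)
    show "holo_polydisc (\<lambda>z. f (vupd z k (c l)))"
      by (rule holo_polydisc_vupd[OF insert.prems(1) c])
    show "cmod (f (vupd z k (c l))) \<le> C" if "z \<in> polydisc" for z
      by (intro insert.prems(2) vupd_polydisc that c)
    show "f (vupd z k (c l)) = f (vupd w k (c l))"
      if "z \<in> polydisc" "w \<in> polydisc" "\<forall>k\<in>F. z $ k = w $ k" for z w
      by (intro insert.prems(3) vupd_polydisc that c) (use that in \<open>auto simp: vupd_nth\<close>)
  qed (rule \<delta>)
  then obtain P where P: "\<And>l. polyfun (P l)"
    "\<And>l z. z \<in> cpolydisc \<Longrightarrow> cmod (f (vupd (r *\<^sub>R z) k (c l)) - P l z) < \<delta>" by metis
  \<comment> \<open>This is the interpolation coefficient of the slice in direction k, with each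
    sampled value replaced by its polynomial approximant in the other variables.\<close>
  define Q where "Q z j = (\<Sum>l<N. P l z * cnj (unity_node N l) ^ j) / of_nat N" for z j
  define p where "p z = (\<Sum>j<N. Q z j * (z $ k) ^ j)" for z
  have Q: "polyfun (\<lambda>z. Q z j)" for j
  proof -
    have "polyfun (\<lambda>z. \<Sum>l<N. (cnj (unity_node N l) ^ j / of_nat N) * P l z)"
      by (intro polyfun_sum polyfun_cmult P) simp
    then show ?thesis by (simp add: Q_def sum_divide_distrib mult.commute)
  qed
  have pp: "polyfun p"
    unfolding p_def by (intro polyfun_sum polyfun_mult_coord Q) simp
  have "cmod (f (r *\<^sub>R z) - p z) < \<epsilon>" if z: "z \<in> cpolydisc" for z
  proof -
    define g where "g \<zeta> = f (vupd (r *\<^sub>R z) k \<zeta>)" for \<zeta>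
    have rz: "r *\<^sub>R z \<in> polydisc" by (rule scaleR_cpolydisc[OF z r])
    have "g holomorphic_on ball 0 1"
      using insert.prems(1) rz unfolding g_def holo_polydisc_def vupd_def by blast
    moreover have "cmod (g u) \<le> C" if "cmod u < 1" for u
      unfolding g_def by (intro insert.prems(2) vupd_polydisc rz that)
    moreover have "cmod (z $ k) \<le> 1" using z by (simp add: cpolydisc_def)
    ultimately have "cmod (g (of_real r * z $ k)
        - (\<Sum>j<N. interp_coeff N (\<lambda>u. g (of_real r * u)) j * (z $ k) ^ j))
        \<le> (1 + real N) * (C * \<rho> ^ N / (1 - \<rho>))"
      unfolding \<rho>_def by (intro interpolation_error r)
    also note N(1)
    finally have "cmod (g (of_real r * z $ k)
        - (\<Sum>j<N. interp_coeff N (\<lambda>u. g (of_real r * u)) j * (z $ k) ^ j)) < \<epsilon> / 2" .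
    moreover have "g (of_real r * z $ k) = f (r *\<^sub>R z)"
    proof -
      have "vupd (r *\<^sub>R z) k (of_real r * z $ k) = r *\<^sub>R z"
        by (auto simp: vec_eq_iff vupd_nth scaleR_conv_of_real[where 'a = complex])
      then show ?thesis by (simp add: g_def)
    qed
    moreover have "cmod ((\<Sum>j<N. interp_coeff N (\<lambda>u. g (of_real r * u)) j * (z $ k) ^ j) - p z)
        \<le> real (card {..<N}) * \<delta>"
      unfolding p_def sum_subtractf[symmetric]
    proof (rule sum_norm_bound)
      fix j
      have "interp_coeff N (\<lambda>u. g (of_real r * u)) j - Q z j
          = (\<Sum>l<N. (f (vupd (r *\<^sub>R z) k (c l)) - P l z) * cnj (unity_node N l) ^ j) / of_nat N"
        by (simp add: interp_coeff_def Q_def g_def c_def diff_divide_distrib left_diff_distrib sum_subtractf)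
      also have "cmod \<dots> \<le> (real (card {..<N}) * \<delta>) / N"
        unfolding norm_divide norm_of_nat
        by (intro divide_right_mono sum_norm_bound)
           (use P(2)[OF z] in \<open>simp_all add: norm_mult norm_power less_imp_le\<close>)
      also have "\<dots> = \<delta>" using N by simp
      finally have "cmod (interp_coeff N (\<lambda>u. g (of_real r * u)) j - Q z j) * cmod (z $ k) ^ j \<le> \<delta> * 1"
        using \<delta> z by (intro mult_mono power_le_one) (auto simp: cpolydisc_def)
      then show "cmod (interp_coeff N (\<lambda>u. g (of_real r * u)) j * (z $ k) ^ j - Q z j * (z $ k) ^ j) \<le> \<delta>"
        by (simp add: norm_mult norm_power flip: left_diff_distrib)
    qed
    moreover have "real (card {..<N}) * \<delta> = \<epsilon> / 2" using N by (simp add: \<delta>_def)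
    ultimately show ?thesis
      using norm_triangle_lt[of "f (r *\<^sub>R z) - (\<Sum>j<N. interp_coeff N (\<lambda>u. g (of_real r * u)) j * (z $ k) ^ j)"
          "(\<Sum>j<N. interp_coeff N (\<lambda>u. g (of_real r * u)) j * (z $ k) ^ j) - p z" \<epsilon>] by simp
  qed
  with pp show ?case by blast
qed

theorem polyfun_approx:
  fixes f :: "complex^'n::finite \<Rightarrow> complex"
  assumes "holo_polydisc f" "\<And>z. z \<in> polydisc \<Longrightarrow> cmod (f z) \<le> C" "0 \<le> r" "r < 1" "0 < \<epsilon>"
  shows "\<exists>p. polyfun p \<and> (\<forall>z\<in>cpolydisc. cmod (f (r *\<^sub>R z) - p z) < \<epsilon>)"
proof (rule polyfun_approx_aux[of UNIV f C r])
  fix z w :: "complex^'n" assume "\<forall>k\<in>UNIV. z $ k = w $ k"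
  then have "z = w" by (simp add: vec_eq_iff)
  then show "f z = f w" by simp
qed (use assms in auto)

section \<open>Characters of the torus\<close>

lemma integral_lborel_prod:
  fixes F :: "'a::euclidean_space \<Rightarrow> real \<Rightarrow> complex"
  assumes F: "\<And>b. b \<in> Basis \<Longrightarrow> integrable lborel (F b)"
  shows "(\<integral>x. (\<Prod>b\<in>Basis. F b (x \<bullet> b)) \<partial>lborel) = (\<Prod>b\<in>Basis. \<integral>t. F b t \<partial>lborel)"
proof -
  interpret product_sigma_finite "\<lambda>_::'a. lborel :: real measure"
    by (intro product_sigma_finite.intro) (rule lborel.sigma_finite_measure_axioms)
  have Fm: "F b \<in> borel_measurable borel" if "b \<in> Basis" for b
    using borel_measurable_integrable[OF F[OF that]] by simp
  have G: "(\<lambda>x::'a. \<Prod>b\<in>Basis. F b (x \<bullet> b)) \<in> borel_measurable borel"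
    by (intro borel_measurable_prod measurable_compose[OF _ Fm]) auto
  have "(\<integral>x. (\<Prod>b\<in>Basis. F b (x \<bullet> b)) \<partial>(lborel :: 'a measure))
      = (\<integral>x. (\<Prod>b\<in>Basis. F b (x \<bullet> b))
           \<partial>distr (\<Pi>\<^sub>M b\<in>(Basis :: 'a set). lborel) borel (\<lambda>f. \<Sum>b\<in>Basis. f b *\<^sub>R b))"
    using lborel_eq[where 'a = 'a] by (rule arg_cong[where f = "\<lambda>M. integral\<^sup>L M _"])
  also have "\<dots> = (\<integral>f. (\<Prod>b\<in>Basis. F b ((\<Sum>b\<in>Basis. f b *\<^sub>R b) \<bullet> b)) \<partial>(\<Pi>\<^sub>M b\<in>(Basis :: 'a set). lborel))"
    by (rule integral_distr[OF _ G]) simp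
  also have "\<dots> = (\<integral>f. (\<Prod>b\<in>Basis. F b (f b)) \<partial>(\<Pi>\<^sub>M b\<in>(Basis :: 'a set). lborel))"
    by (intro Bochner_Integration.integral_cong refl prod.cong) (simp add: inner_sum_left_Basis)
  also have "\<dots> = (\<Prod>b\<in>Basis. \<integral>t. F b t \<partial>lborel)"
    by (rule product_integral_prod) (auto intro: F)
  finally show ?thesis .
qed

lemma integral_cis_Icc:
  fixes n :: int
  shows "integrable lborel (\<lambda>t. indicator {0..1} t *\<^sub>R cis (2 * pi * of_int n * t))"
    and "(\<integral>t. indicator {0..1} t *\<^sub>R cis (2 * pi * of_int n * t) \<partial>lborel) = (if n = 0 then 1 else 0)"
proof -
  show "integrable lborel (\<lambda>t. indicator {0..1} t *\<^sub>R cis (2 * pi * of_int n * t))"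
    using borel_integrable_compact[of "{0..1::real}" "\<lambda>t. cis (2 * pi * of_int n * t)"]
    by (simp add: continuous_intros set_integrable_def)
  show "(\<integral>t. indicator {0..1} t *\<^sub>R cis (2 * pi * of_int n * t) \<partial>lborel) = (if n = 0 then 1 else 0)"
  proof (cases "n = 0")
    case True
    then show ?thesis by simp
  next
    case False
    define c where "c = 2 * pi * of_int n"
    have c: "c \<noteq> 0" using False by (simp add: c_def)
    define F where "F t = cis (c * t) / (\<i> * of_real c)" for t
    have "(\<integral>t. indicator {0..1} t *\<^sub>R cis (c * t) \<partial>lborel) = F 1 - F 0"
    proof (rule integral_FTC_Icc)
      fix t :: real
      have "((\<lambda>t. cis (c * t)) has_vector_derivative (c *\<^sub>R (\<i> * cis (c * t)))) (at t within {0..1})"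
        unfolding cis_conv_exp
        by (auto intro!: derivative_eq_intros has_vector_derivative_real_field simp: scaleR_conv_of_real mult_ac)
      from has_vector_derivative_divide[OF this, of "\<i> * of_real c"]
      show "(F has_vector_derivative cis (c * t)) (at t within {0..1})"
        using c by (simp add: F_def[abs_def] scaleR_conv_of_real)
    qed (auto intro!: continuous_intros)
    also have "F 1 - F 0 = 0" by (simp add: F_def c_def)
    finally show ?thesis using False by (simp add: c_def)
  qed
qed

text \<open>\<open>tmeas\<close> restricts the completed measure, while the product formula above is
  about \<open>lborel\<close>; for Borel integrands the completion changes nothing.\<close>

lemma tmeas_lborel_integral:
  fixes f :: "real^'n::finite \<Rightarrow> complex"
  assumes "f \<in> borel_measurable borel"
  shows "integral\<^sup>L tmeas f = (\<integral>x. indicator (cbox 0 One) x *\<^sub>R f x \<partial>lborel)"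
proof -
  have "integral\<^sup>L tmeas f = (\<integral>x. indicator (cbox 0 One) x *\<^sub>R f x \<partial>lebesgue)"
    unfolding tmeas_def by (rule integral_restrict_space) simp
  also have "\<dots> = (\<integral>x. indicator (cbox 0 One) x *\<^sub>R f x \<partial>lborel)"
    using assms by (intro integral_completion) simp
  finally show ?thesis .
qed

definition torus_char :: "('n::finite \<Rightarrow> int) \<Rightarrow> real^'n \<Rightarrow> complex" where
  "torus_char \<alpha> \<theta> = cis (2 * pi * (\<Sum>k\<in>UNIV. of_int (\<alpha> k) * \<theta> $ k))"

lemma continuous_on_torus_char [continuous_intros]: "continuous_on S (torus_char \<alpha>)"
  unfolding torus_char_def by (intro continuous_intros)

lemma norm_torus_char [simp]: "cmod (torus_char \<alpha> \<theta>) = 1"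
  by (simp add: torus_char_def)

lemma torus_char_zero [simp]: "torus_char (\<lambda>_. 0) \<theta> = 1"
  by (simp add: torus_char_def)

lemma torus_char_mult: "torus_char \<alpha> \<theta> * torus_char \<beta> \<theta> = torus_char (\<lambda>k. \<alpha> k + \<beta> k) \<theta>"
  by (simp add: torus_char_def cis_mult sum.distrib distrib_left distrib_right)

lemma cnj_torus_char: "cnj (torus_char \<alpha> \<theta>) = torus_char (\<lambda>k. - \<alpha> k) \<theta>"
  by (simp add: torus_char_def cis_cnj sum_negf)

lemma fourier_torus_char: "fourier f \<alpha> = (\<integral>\<theta>. f \<theta> * torus_char (\<lambda>k. - \<alpha> k) \<theta> \<partial>tmeas)"
  by (simp add: fourier_def torus_char_def sum_negf)

lemma cis_sum: "finite A \<Longrightarrow> cis (\<Sum>a\<in>A. f a) = (\<Prod>a\<in>A. cis (f a))"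
  by (induction A rule: finite_induct) (auto simp: cis_mult[symmetric])

lemma torus_char_prod: "torus_char \<alpha> \<theta> = (\<Prod>k\<in>UNIV. cis (2 * pi * of_int (\<alpha> k) * \<theta> $ k))"
  by (simp add: torus_char_def sum_distrib_left cis_sum mult.assoc)

lemma tpt_power_prod: "(\<Prod>k\<in>UNIV. (tpt \<theta> $ k) ^ \<alpha> k) = torus_char (\<lambda>k. int (\<alpha> k)) \<theta>"
  by (simp add: torus_char_prod tpt_def Complex.DeMoivre mult_ac)

theorem integral_torus_char:
  fixes \<alpha> :: "'n::finite \<Rightarrow> int"
  shows "integral\<^sup>L tmeas (torus_char \<alpha>) = (if \<alpha> = (\<lambda>_. 0) then 1 else 0)"
proof -
  \<comment> \<open>The frequency as a vector: the phase is then an inner product, and both it and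
    the indicator of the cube split over \<open>Basis\<close>.\<close>
  define a :: "real^'n" where "a = (\<chi> k. of_int (\<alpha> k))"
  have Basis: "b \<in> Basis \<Longrightarrow> \<exists>k. b = axis k 1" for b :: "real^'n"
    by (auto simp: Basis_vec_def)
  have ab: "a \<bullet> axis k 1 = of_int (\<alpha> k)" for k
    by (simp add: a_def inner_axis)
  define F where "F b t = indicator {0..1} t *\<^sub>R cis (2 * pi * (a \<bullet> b) * t)" for b :: "real^'n" and t :: real
  have F: "integrable lborel (F b)" "integral\<^sup>L lborel (F b) = (if a \<bullet> b = 0 then 1 else 0)"
    if "b \<in> Basis" for b
    using Basis[OF that] integral_cis_Icc by (auto simp: F_def[abs_def] ab)
  have "indicator (cbox 0 One) \<theta> *\<^sub>R torus_char \<alpha> \<theta> = (\<Prod>b\<in>Basis. F b (\<theta> \<bullet> b))" for \<theta> :: "real^'n"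
  proof -
    have "(\<Prod>b\<in>Basis. F b (\<theta> \<bullet> b)) = of_real (\<Prod>b\<in>Basis. indicator {0..1} (\<theta> \<bullet> b))
        * (\<Prod>b\<in>Basis. cis (2 * pi * (a \<bullet> b) * (\<theta> \<bullet> b)))"
      by (simp add: F_def scaleR_conv_of_real prod.distrib)
    also have "(\<Prod>b\<in>Basis. indicator {0..1} (\<theta> \<bullet> b)) = (indicator (cbox 0 One) \<theta> :: real)"
      by (auto simp: indicator_def mem_box intro!: prod.neutral)
    also have "(\<Prod>b\<in>Basis. cis (2 * pi * (a \<bullet> b) * (\<theta> \<bullet> b))) = cis (2 * pi * (a \<bullet> \<theta>))"
      by (subst euclidean_inner) (simp add: cis_sum sum_distrib_left mult.assoc)
    also have "a \<bullet> \<theta> = (\<Sum>k\<in>UNIV. of_int (\<alpha> k) * \<theta> $ k)"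
      by (simp add: inner_vec_def a_def)
    finally show ?thesis by (simp add: torus_char_def scaleR_conv_of_real)
  qed
  then have "integral\<^sup>L tmeas (torus_char \<alpha>) = (\<integral>\<theta>. (\<Prod>b\<in>Basis. F b (\<theta> \<bullet> b)) \<partial>lborel)"
    using tmeas_lborel_integral[OF borel_measurable_continuous_onI[OF continuous_on_torus_char[of UNIV \<alpha>]]]
    by simp
  also have "\<dots> = (\<Prod>b\<in>Basis. if a \<bullet> b = 0 then 1 else 0)"
    using F by (simp add: integral_lborel_prod)
  also have "\<dots> = (if \<alpha> = (\<lambda>_. 0) then 1 else 0)"
  proof (cases "\<alpha> = (\<lambda>_. 0)")
    case True
    then have "a = 0" by (simp add: a_def vec_eq_iff)
    then show ?thesis using True by simp
  next
    case False
    then obtain k where "\<alpha> k \<noteq> 0" by auto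
    then have "a \<bullet> axis k 1 \<noteq> 0" "axis k 1 \<in> (Basis :: (real^'n) set)"
      by (auto simp: ab)
    then have "(\<Prod>b\<in>Basis. if a \<bullet> b = 0 then 1 else 0 :: complex) = 0"
      by (intro prod_zero) auto
    then show ?thesis using False by simp
  qed
  finally show ?thesis .
qed

section \<open>Square-integrable functions on the torus\<close>

lemma emeasure_space_tmeas: "emeasure tmeas (space (tmeas :: (real^'n::finite) measure)) = 1"
  by (simp add: tmeas_def emeasure_restrict_space emeasure_lborel_cbox_eq)

interpretation tmeas: finite_measure "tmeas :: (real^'n::finite) measure"
  by standard (simp add: emeasure_space_tmeas)

lemma continuous_integrable_tmeas:
  fixes f :: "real^'n::finite \<Rightarrow> 'b::euclidean_space"
  assumes "continuous_on UNIV f" shows "integrable tmeas f"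
  unfolding tmeas_def by (rule continuous_imp_integrable, rule continuous_on_subset[OF assms]) simp

lemma integrable_continuous_mult:
  fixes f u :: "real^'n::finite \<Rightarrow> complex"
  assumes f: "continuous_on UNIV f" and u: "integrable tmeas u"
  shows "integrable tmeas (\<lambda>\<theta>. f \<theta> * u \<theta>)"
proof -
  \<comment> \<open>The function may be unbounded on the whole space, but the space of
    \<open>tmeas\<close> is the closed cube, and there it is bounded.\<close>
  have "compact (f ` cbox 0 One)"
    by (intro compact_continuous_image continuous_on_subset[OF f]) auto
  then obtain B where B: "\<And>\<theta>. \<theta> \<in> cbox 0 One \<Longrightarrow> cmod (f \<theta>) \<le> B"
    using compact_imp_bounded bounded_iff by (metis imageI)
  have [measurable]: "f \<in> borel_measurable tmeas" "u \<in> borel_measurable tmeas"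
    using borel_measurable_integrable[OF u]
      borel_measurable_integrable[OF continuous_integrable_tmeas[OF f]] by auto
  show ?thesis
  proof (rule Bochner_Integration.integrable_bound)
    show "integrable tmeas (\<lambda>\<theta>. B * cmod (u \<theta>))"
      by (intro integrable_mult_right integrable_norm u)
    show "AE \<theta> in tmeas. norm (f \<theta> * u \<theta>) \<le> norm (B * cmod (u \<theta>))"
    proof (rule AE_I2)
      fix \<theta> :: "real^'n" assume "\<theta> \<in> space tmeas"
      then have "cmod (f \<theta>) \<le> \<bar>B\<bar>" using B[of \<theta>] by (simp add: tmeas_def)
      then show "norm (f \<theta> * u \<theta>) \<le> norm (B * cmod (u \<theta>))"
        by (simp add: norm_mult abs_mult mult_right_mono)
    qed
  qed simp
qed

lemma norm_integral_mult_le: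
  fixes f u :: "real^'n::finite \<Rightarrow> complex"
  assumes u: "integrable tmeas u" and B: "\<And>\<theta>. cmod (f \<theta>) \<le> B"
  shows "cmod (\<integral>\<theta>. f \<theta> * u \<theta> \<partial>tmeas) \<le> B * (\<integral>\<theta>. cmod (u \<theta>) \<partial>tmeas)"
proof (cases "integrable tmeas (\<lambda>\<theta>. f \<theta> * u \<theta>)")
  case True
  have "cmod (\<integral>\<theta>. f \<theta> * u \<theta> \<partial>tmeas) \<le> (\<integral>\<theta>. cmod (f \<theta> * u \<theta>) \<partial>tmeas)"
    by (rule integral_norm_bound)
  also have "\<dots> \<le> (\<integral>\<theta>. B * cmod (u \<theta>) \<partial>tmeas)"
    using u integrable_norm[OF True] by (intro integral_mono) (auto simp: norm_mult intro!: mult_right_mono B)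
  finally show ?thesis by simp
next
  \<comment> \<open>A product that is not integrable has integral 0 by convention, so only the sign
    of the right-hand side matters.\<close>
  case False
  have "0 \<le> B" using B order_trans norm_ge_zero by blast
  then show ?thesis using False by (simp add: not_integrable_integral_eq)
qed

lemma uniform_limit_integral_tmeas:
  fixes f :: "nat \<Rightarrow> real^'n::finite \<Rightarrow> complex"
  assumes lim: "uniform_limit UNIV f g sequentially" and f: "\<And>N. continuous_on UNIV (f N)"
    and u: "integrable tmeas u"
  shows "(\<lambda>N. \<integral>\<theta>. f N \<theta> * u \<theta> \<partial>tmeas) \<longlonglongrightarrow> (\<integral>\<theta>. g \<theta> * u \<theta> \<partial>tmeas)"
proof (rule LIMSEQ_I)
  fix e :: real assume e: "e > 0"
  have g: "continuous_on UNIV g"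
    by (rule uniform_limit_theorem[OF _ lim]) (use f in auto)
  define I where "I = (\<integral>\<theta>. cmod (u \<theta>) \<partial>tmeas)"
  have I: "0 \<le> I" by (simp add: I_def)
  \<comment> \<open>The summand 1 guards against division by zero when u vanishes almost
    everywhere.\<close>
  define d where "d = e / (I + 1)"
  have d: "d > 0" using e I by (simp add: d_def)
  obtain N0 where N0: "\<And>N \<theta>. N \<ge> N0 \<Longrightarrow> dist (f N \<theta>) (g \<theta>) < d"
    using lim d unfolding uniform_limit_sequentially_iff by blast
  show "\<exists>N0. \<forall>N\<ge>N0. norm ((\<integral>\<theta>. f N \<theta> * u \<theta> \<partial>tmeas) - (\<integral>\<theta>. g \<theta> * u \<theta> \<partial>tmeas)) < e"
  proof (intro exI allI impI)
    fix N assume N: "N \<ge> N0"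
    have "(\<integral>\<theta>. f N \<theta> * u \<theta> \<partial>tmeas) - (\<integral>\<theta>. g \<theta> * u \<theta> \<partial>tmeas)
        = (\<integral>\<theta>. (f N \<theta> - g \<theta>) * u \<theta> \<partial>tmeas)"
      using integrable_continuous_mult[OF f u] integrable_continuous_mult[OF g u]
      by (simp add: left_diff_distrib)
    also have "cmod \<dots> \<le> d * I"
      unfolding I_def by (rule norm_integral_mult_le[OF u])
        (use N0[OF N] in \<open>simp add: dist_norm less_imp_le\<close>)
    also have "\<dots> < e"
      using e I by (simp add: d_def field_simps)
    finally show "norm ((\<integral>\<theta>. f N \<theta> * u \<theta> \<partial>tmeas) - (\<integral>\<theta>. g \<theta> * u \<theta> \<partial>tmeas)) < e" .
  qed
qed

lemma L2_measurable: "f \<in> L2 \<Longrightarrow> f \<in> borel_measurable tmeas"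
  by (simp add: L2_def)

lemma L2_mult_integrable:
  assumes f: "f \<in> L2" and g: "g \<in> L2"
  shows "integrable tmeas (\<lambda>\<theta>. f \<theta> * g \<theta>)"
proof (rule Bochner_Integration.integrable_bound)
  have [measurable]: "f \<in> borel_measurable tmeas" "g \<in> borel_measurable tmeas"
    using assms by (auto intro: L2_measurable)
  show "(\<lambda>\<theta>. f \<theta> * g \<theta>) \<in> borel_measurable tmeas" by simp
  show "integrable tmeas (\<lambda>\<theta>. (cmod (f \<theta>))\<^sup>2 + (cmod (g \<theta>))\<^sup>2)"
    using assms by (auto simp: L2_def)
  show "AE \<theta> in tmeas. norm (f \<theta> * g \<theta>) \<le> norm ((cmod (f \<theta>))\<^sup>2 + (cmod (g \<theta>))\<^sup>2)"
  proof (rule AE_I2)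
    fix \<theta>
    have "0 \<le> (cmod (f \<theta>) - cmod (g \<theta>))\<^sup>2" "0 \<le> cmod (f \<theta>) * cmod (g \<theta>)" by auto
    then have "cmod (f \<theta>) * cmod (g \<theta>) \<le> (cmod (f \<theta>))\<^sup>2 + (cmod (g \<theta>))\<^sup>2"
      unfolding power2_diff by linarith
    then show "norm (f \<theta> * g \<theta>) \<le> norm ((cmod (f \<theta>))\<^sup>2 + (cmod (g \<theta>))\<^sup>2)"
      by (simp add: norm_mult)
  qed
qed

lemma L2_continuous: "continuous_on UNIV f \<Longrightarrow> f \<in> L2"
  unfolding L2_def
  by (auto intro!: continuous_integrable_tmeas continuous_intros
      borel_measurable_integrable[OF continuous_integrable_tmeas])

lemma L2_integrable: "f \<in> L2 \<Longrightarrow> integrable tmeas f"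
  using L2_mult_integrable[of f "\<lambda>_. 1"] L2_continuous[of "\<lambda>_. 1"] by simp

lemma L2_cnj: "f \<in> L2 \<Longrightarrow> (\<lambda>\<theta>. cnj (f \<theta>)) \<in> L2"
  by (auto simp: L2_def intro!: measurable_compose[OF _ borel_measurable_continuous_onI[of cnj]] continuous_intros)

lemma L2_cmult: "f \<in> L2 \<Longrightarrow> (\<lambda>\<theta>. c * f \<theta>) \<in> L2"
  by (auto simp: L2_def norm_mult power_mult_distrib)

lemma L2_add:
  assumes f: "f \<in> L2" and g: "g \<in> L2"
  shows "(\<lambda>\<theta>. f \<theta> + g \<theta>) \<in> L2"
proof -
  have [measurable]: "f \<in> borel_measurable tmeas" "g \<in> borel_measurable tmeas"
    using assms by (auto intro: L2_measurable)
  have "integrable tmeas (\<lambda>\<theta>. (cmod (f \<theta> + g \<theta>))\<^sup>2)"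
  proof (rule Bochner_Integration.integrable_bound)
    show "integrable tmeas (\<lambda>\<theta>. 2 * (cmod (f \<theta>))\<^sup>2 + 2 * (cmod (g \<theta>))\<^sup>2)"
      using assms by (auto simp: L2_def)
    show "AE \<theta> in tmeas. norm ((cmod (f \<theta> + g \<theta>))\<^sup>2) \<le> norm (2 * (cmod (f \<theta>))\<^sup>2 + 2 * (cmod (g \<theta>))\<^sup>2)"
    proof (rule AE_I2)
      fix \<theta>
      have "(cmod (f \<theta> + g \<theta>))\<^sup>2 \<le> (cmod (f \<theta>) + cmod (g \<theta>))\<^sup>2"
        by (intro power_mono norm_triangle_ineq) simp
      moreover have "0 \<le> (cmod (f \<theta>) - cmod (g \<theta>))\<^sup>2" by simp
      ultimately show "norm ((cmod (f \<theta> + g \<theta>))\<^sup>2) \<le> norm (2 * (cmod (f \<theta>))\<^sup>2 + 2 * (cmod (g \<theta>))\<^sup>2)"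
        by (simp add: power2_sum power2_diff)
    qed
  qed simp
  then show ?thesis by (simp add: L2_def)
qed

lemma linner_integrable: "f \<in> L2 \<Longrightarrow> g \<in> L2 \<Longrightarrow> integrable tmeas (\<lambda>\<theta>. f \<theta> * cnj (g \<theta>))"
  by (intro L2_mult_integrable L2_cnj)

lemma linner_add_left: "f \<in> L2 \<Longrightarrow> g \<in> L2 \<Longrightarrow> h \<in> L2 \<Longrightarrow>
    linner (\<lambda>\<theta>. f \<theta> + g \<theta>) h = linner f h + linner g h"
  by (simp add: linner_def distrib_right linner_integrable)

lemma linner_cmult_left: "linner (\<lambda>\<theta>. c * f \<theta>) h = c * linner f h"
  by (simp add: linner_def mult.assoc)

lemma cnj_linner: "cnj (linner f g) = linner g f"
proof -
  have "cnj (linner f g) = (\<integral>\<theta>. cnj (f \<theta> * cnj (g \<theta>)) \<partial>tmeas)"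
    unfolding linner_def by (rule Bochner_Integration.integral_cnj[symmetric])
  then show ?thesis by (simp add: linner_def mult.commute)
qed

section \<open>The three function spaces and the characters they contain\<close>

lemma H2_subset_L2: "H2 \<subseteq> L2" by (auto simp: H2_def)
lemma H2_0_subset_H2: "H2_0 \<subseteq> H2" by (auto simp: H2_0_def)
lemma Mn_subset_L2: "Mn \<subseteq> L2" by (auto simp: Mn_def)

lemma integrable_times_char: "f \<in> L2 \<Longrightarrow> integrable tmeas (\<lambda>\<theta>. f \<theta> * torus_char \<alpha> \<theta>)"
  by (rule L2_mult_integrable[OF _ L2_continuous]) (auto intro: continuous_intros)

lemma fourier_add: "f \<in> L2 \<Longrightarrow> g \<in> L2 \<Longrightarrow> fourier (\<lambda>\<theta>. f \<theta> + g \<theta>) \<alpha> = fourier f \<alpha> + fourier g \<alpha>"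
  by (simp add: fourier_torus_char distrib_right integrable_times_char)

lemma fourier_cmult: "fourier (\<lambda>\<theta>. c * f \<theta>) \<alpha> = c * fourier f \<alpha>"
  by (simp add: fourier_torus_char mult.assoc)

lemma H2_fourier_eq_0: "f \<in> H2 \<Longrightarrow> \<alpha> k < 0 \<Longrightarrow> fourier f \<alpha> = 0"
  by (auto simp: H2_def)

lemma H2_add: "f \<in> H2 \<Longrightarrow> g \<in> H2 \<Longrightarrow> (\<lambda>\<theta>. f \<theta> + g \<theta>) \<in> H2"
  by (auto simp: H2_def fourier_add L2_add)

lemma H2_cmult: "f \<in> H2 \<Longrightarrow> (\<lambda>\<theta>. c * f \<theta>) \<in> H2"
  by (auto simp: H2_def fourier_cmult L2_cmult)

lemma hval_zero: "hval f 0 = integral\<^sup>L tmeas f"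
  by (simp add: hval_def linner_def szk_def szego_def)

lemma H2_0_add: "f \<in> H2_0 \<Longrightarrow> g \<in> H2_0 \<Longrightarrow> (\<lambda>\<theta>. f \<theta> + g \<theta>) \<in> H2_0"
  by (simp add: H2_0_def H2_add hval_zero L2_integrable H2_subset_L2[THEN subsetD])

lemma H2_0_cmult: "f \<in> H2_0 \<Longrightarrow> (\<lambda>\<theta>. c * f \<theta>) \<in> H2_0"
  by (auto simp: H2_0_def H2_cmult hval_zero)

lemma setsum_conjset_H2_subset_L2: "setsum (conjset H2) H2 \<subseteq> L2"
  using H2_subset_L2 by (auto simp: setsum_def conjset_def intro!: L2_add L2_cnj)

lemma Mn_add: "f \<in> Mn \<Longrightarrow> g \<in> Mn \<Longrightarrow> (\<lambda>\<theta>. f \<theta> + g \<theta>) \<in> Mn"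
  using setsum_conjset_H2_subset_L2 by (auto simp: Mn_def L2_add linner_add_left subset_iff)

lemma Mn_cmult: "f \<in> Mn \<Longrightarrow> (\<lambda>\<theta>. c * f \<theta>) \<in> Mn"
  by (auto simp: Mn_def L2_cmult linner_cmult_left)

lemma torus_char_H2:
  assumes "\<forall>k. 0 \<le> \<alpha> k" shows "torus_char \<alpha> \<in> H2"
proof -
  have "fourier (torus_char \<alpha>) \<beta> = 0" if "\<beta> k < 0" for \<beta> k
  proof -
    have "\<alpha> k + - \<beta> k > 0"
      using that assms[rule_format, of k] by linarith
    then have "(\<lambda>k. \<alpha> k + - \<beta> k) \<noteq> (\<lambda>_. 0)" by (metis less_irrefl)
    then show ?thesis
      unfolding fourier_torus_char torus_char_mult by (subst integral_torus_char) (rule if_not_P)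
  qed
  then show ?thesis by (auto simp: H2_def intro!: L2_continuous continuous_intros)
qed

lemma torus_char_H2_0:
  assumes "\<forall>k. 0 \<le> \<alpha> k" "\<alpha> \<noteq> (\<lambda>_. 0)" shows "torus_char \<alpha> \<in> H2_0"
  using assms by (simp add: H2_0_def torus_char_H2 hval_zero integral_torus_char)

text \<open>Functions in \<open>H2\<close> have no frequency with a negative coordinate. Coordinate
  i of \<alpha> thus gives orthogonality to \<open>H2\<close>, and coordinate j, negative in the
  frequency of the conjugate character, gives orthogonality to the conjugate of
  \<open>H2\<close>.\<close>

lemma torus_char_Mn:
  fixes \<alpha> :: "'n::finite \<Rightarrow> int"
  assumes "\<alpha> i < 0" "0 < \<alpha> j" shows "torus_char \<alpha> \<in> Mn"
  unfolding Mn_def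
proof (intro CollectI conjI ballI)
  show L: "torus_char \<alpha> \<in> L2" by (intro L2_continuous continuous_intros)
  fix h :: "real^'n \<Rightarrow> complex" assume "h \<in> setsum (conjset H2) H2"
  then obtain f g where fg: "f \<in> H2" "g \<in> H2" and h: "h = (\<lambda>\<theta>. cnj (f \<theta>) + g \<theta>)"
    by (auto simp: setsum_def conjset_def)
  have fL: "f \<in> L2" "g \<in> L2" using fg H2_subset_L2 by auto
  have "fourier f (\<lambda>k. - \<alpha> k) = 0" "fourier g \<alpha> = 0"
    using H2_fourier_eq_0[of f _ j] H2_fourier_eq_0[of g _ i] fg assms by auto
  moreover have "linner h (torus_char \<alpha>) = cnj (fourier f (\<lambda>k. - \<alpha> k)) + fourier g \<alpha>"
    using linner_add_left[OF L2_cnj[OF fL(1)] fL(2) L]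
      Bochner_Integration.integral_cnj[of tmeas "\<lambda>\<theta>. f \<theta> * torus_char \<alpha> \<theta>"]
    by (simp add: h linner_def fourier_torus_char cnj_torus_char)
  ultimately show "linner (torus_char \<alpha>) h = 0"
    using cnj_linner[of h "torus_char \<alpha>"] by simp
qed

text \<open>The integral is the Fourier coefficient of c at - \<alpha>. At frequency 0 it is the
  value at the origin; otherwise - \<alpha> has a negative coordinate.\<close>

lemma integral_char_H2_0:
  assumes "c \<in> H2_0" "\<forall>k. 0 \<le> \<alpha> k"
  shows "(\<integral>\<theta>. torus_char \<alpha> \<theta> * c \<theta> \<partial>tmeas) = 0"
proof (cases "\<alpha> = (\<lambda>_. 0)")
  case True
  then show ?thesis using assms by (simp add: H2_0_def hval_zero)
next
  case False
  then obtain k where "\<alpha> k \<noteq> 0" by auto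
  with assms(2) have "- \<alpha> k < 0" by (metis le_less neg_less_0_iff_less)
  then have "fourier c (\<lambda>k. - \<alpha> k) = 0" using assms(1) H2_0_subset_H2 H2_fourier_eq_0[of c "\<lambda>k. - \<alpha> k" k] by blast
  then show ?thesis by (simp add: fourier_torus_char mult.commute)
qed

lemma integral_char_Mn:
  fixes \<alpha> :: "'n::finite \<Rightarrow> int"
  assumes "b \<in> Mn" "\<forall>k. 0 \<le> \<alpha> k"
  shows "(\<integral>\<theta>. torus_char \<alpha> \<theta> * b \<theta> \<partial>tmeas) = 0"
proof -
  have "(\<lambda>_::real^'n. 0) \<in> H2" using H2_cmult[OF torus_char_H2[OF assms(2)], of 0] by simp
  then have "(\<lambda>\<theta>. cnj (torus_char \<alpha> \<theta>) + 0) \<in> setsum (conjset H2) H2"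
    unfolding setsum_def conjset_def
    by (intro CollectI exI conjI imageI refl) (use torus_char_H2[OF assms(2)] in auto)
  then have "linner b (\<lambda>\<theta>. cnj (torus_char \<alpha> \<theta>)) = 0"
    using assms(1) by (simp add: Mn_def)
  then show ?thesis by (simp add: linner_def mult.commute)
qed

text \<open>Uniform convergence survives multiplication when the limits are bounded, so boundedness
  of the partial product is carried through the induction.\<close>

lemma uniform_limit_prod:
  fixes f :: "'k \<Rightarrow> 'i \<Rightarrow> 'x \<Rightarrow> complex"
  assumes "finite A" "\<And>k. k \<in> A \<Longrightarrow> uniform_limit S (f k) (g k) F" "\<And>k. k \<in> A \<Longrightarrow> bounded (g k ` S)"
  shows "uniform_limit S (\<lambda>n x. \<Prod>k\<in>A. f k n x) (\<lambda>x. \<Prod>k\<in>A. g k x) F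
    \<and> bounded ((\<lambda>x. \<Prod>k\<in>A. g k x) ` S)"
  using assms
proof (induction A rule: finite_induct)
  case empty
  then show ?case by (auto simp: uniform_limit_const intro: bounded_subset[of "{1}"])
next
  case (insert a A)
  then have IH: "uniform_limit S (\<lambda>n x. \<Prod>k\<in>A. f k n x) (\<lambda>x. \<Prod>k\<in>A. g k x) F"
    "bounded ((\<lambda>x. \<Prod>k\<in>A. g k x) ` S)" by auto
  have a: "uniform_limit S (f a) (g a) F" "bounded (g a ` S)" using insert by auto
  have "bounded ((\<lambda>x. g a x * (\<Prod>k\<in>A. g k x)) ` S)"
  proof -
    obtain B C where "\<And>x. x \<in> S \<Longrightarrow> cmod (g a x) \<le> B" "\<And>x. x \<in> S \<Longrightarrow> cmod (\<Prod>k\<in>A. g k x) \<le> C"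
      using IH(2) a(2) by (auto simp: bounded_iff)
    then have "\<forall>x\<in>S. cmod (g a x * (\<Prod>k\<in>A. g k x)) \<le> \<bar>B\<bar> * \<bar>C\<bar>"
      by (force simp: norm_mult intro!: mult_mono)
    then show ?thesis by (auto simp: bounded_iff)
  qed
  then show ?case using insert(1,2) uniform_lim_mult[OF a(1) IH(1) a(2) IH(2)] by simp
qed

lemma uniform_limit_geometric:
  assumes "\<rho> < 1" "0 \<le> \<rho>"
  shows "uniform_limit {u. cmod u \<le> \<rho>} (\<lambda>N u. \<Sum>j\<le>N. u ^ j) (\<lambda>u. inverse (1 - u)) sequentially"
proof -
  have "uniform_limit {u. cmod u \<le> \<rho>} (\<lambda>N u. \<Sum>j<N. u ^ j) (\<lambda>u. \<Sum>j. u ^ j) sequentially"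
  proof (rule Weierstrass_m_test)
    show "summable (\<lambda>j. \<rho> ^ j)" using assms by (intro summable_geometric) simp
  qed (use assms in \<open>auto simp: norm_power intro: power_mono\<close>)
  moreover have "(\<Sum>j. u ^ j) = inverse (1 - u)" if "cmod u \<le> \<rho>" for u
    using that assms suminf_geometric[of u] by (simp add: inverse_eq_divide)
  ultimately have "uniform_limit {u. cmod u \<le> \<rho>} (\<lambda>N u. \<Sum>j<N. u ^ j) (\<lambda>u. inverse (1 - u)) sequentially"
    by (subst uniform_limit_cong'[where g = "\<lambda>N u. \<Sum>j<N. u ^ j" and i = "\<lambda>u. \<Sum>j. u ^ j"]) auto
  \<comment> \<open>The index is shifted so that the last exponent is included, as in the frequency
    ranges used for the kernels.\<close>
  from filterlim_compose[OF this filterlim_Suc] show ?thesis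
    by (simp add: lessThan_Suc_atMost)
qed

section \<open>Cauchy and Poisson kernels\<close>

text \<open>The Fourier coefficients of the one-variable Poisson kernel at z: powers of z on one
  side, powers of its conjugate on the other.\<close>

definition poisson_coeff :: "complex \<Rightarrow> int \<Rightarrow> complex" where
  "poisson_coeff z j = (if 0 \<le> j then z ^ nat j else cnj z ^ nat (- j))"

text \<open>One formula for the partial sums of both kernels: nonnegative frequencies give the
  conjugate Szego kernel, symmetric ones the Poisson kernel. Truncating in each coordinate
  separately preserves the product form, and the result is a finite combination of
  characters.\<close>

definition trunc_kernel :: "int set \<Rightarrow> complex^'n::finite \<Rightarrow> real^'n \<Rightarrow> complex" where
  "trunc_kernel J z \<theta> = (\<Prod>k\<in>UNIV. \<Sum>j\<in>J. poisson_coeff (z $ k) j * cis (- (2 * pi * of_int j * \<theta> $ k)))"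

text \<open>With u = z k * cnj (t k), each factor is twice the real part of 1 / (1 - u), minus 1,
  that is (1 - |u|^2) / |1 - u|^2. It is kept complex-valued, to be compared directly with the Szego
  kernel.\<close>

definition poisson_kernel :: "complex^'n::finite \<Rightarrow> real^'n \<Rightarrow> complex" where
  "poisson_kernel z \<theta> = (\<Prod>k\<in>UNIV. inverse (1 - z $ k * cnj (tpt \<theta> $ k)) + cnj (inverse (1 - z $ k * cnj (tpt \<theta> $ k))) - 1)"

lemma trunc_kernel_expand:
  fixes z :: "complex^'n::finite"
  assumes "finite J"
  shows "trunc_kernel J z \<theta>
    = (\<Sum>\<alpha>\<in>PiE UNIV (\<lambda>_. J). (\<Prod>k\<in>UNIV. poisson_coeff (z $ k) (\<alpha> k)) * torus_char (\<lambda>k. - \<alpha> k) \<theta>)"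
  unfolding trunc_kernel_def
  by (subst prod_sum_PiE) (simp_all add: assms prod.distrib torus_char_prod)

lemma continuous_trunc_kernel [continuous_intros]: "continuous_on S (trunc_kernel J z)"
  unfolding trunc_kernel_def by (intro continuous_intros)

lemma one_minus_neq_0: "cmod u < 1 \<Longrightarrow> 1 - u \<noteq> 0"
  by auto

lemma norm_tpt [simp]: "cmod (tpt \<theta> $ k) = 1"
  by (simp add: tpt_def)

lemma cnj_szk: "cnj (szk z \<theta>) = (\<Prod>k\<in>UNIV. inverse (1 - z $ k * cnj (tpt \<theta> $ k)))"
  by (simp add: szk_def szego_def mult.commute)

lemma continuous_tpt [continuous_intros]: "continuous_on S (\<lambda>\<theta>. tpt \<theta> $ k)"
  unfolding tpt_def by (auto intro!: continuous_intros)

lemma polydisc_times_tpt: "z \<in> polydisc \<Longrightarrow> cmod (z $ k * cnj (tpt \<theta> $ k)) < 1"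
  by (simp add: norm_mult polydisc_def)

lemma continuous_cnj_szk:
  assumes "z \<in> polydisc" shows "continuous_on S (\<lambda>\<theta>. cnj (szk z \<theta>))"
  unfolding cnj_szk using one_minus_neq_0[OF polydisc_times_tpt[OF assms]]
  by (intro continuous_intros) auto

lemma continuous_szk:
  assumes "z \<in> polydisc" shows "continuous_on S (szk z)"
  using continuous_on_cnj[OF continuous_cnj_szk[OF assms]] by simp

lemma szk_L2: "z \<in> polydisc \<Longrightarrow> szk z \<in> L2"
  by (intro L2_continuous continuous_szk)

definition nonneg_range :: "nat \<Rightarrow> int set" where
  "nonneg_range N = int ` {..N}"

text \<open>The negative half starts at 1, so that frequency 0 is counted once; this accounts for
  the - 1 in each factor of the Poisson kernel.\<close>

definition sym_range :: "nat \<Rightarrow> int set" where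
  "sym_range N = int ` {..N} \<union> (\<lambda>j. - int j) ` {1..N}"

lemma poisson_coeff_cis:
  "poisson_coeff z (int j) * cis (- (2 * pi * of_int (int j) * t)) = (z * cnj (cis (2 * pi * t))) ^ j"
  "1 \<le> j \<Longrightarrow> poisson_coeff z (- int j) * cis (- (2 * pi * of_int (- int j) * t)) = cnj (z * cnj (cis (2 * pi * t))) ^ j"
  by (simp_all add: poisson_coeff_def power_mult_distrib cis_cnj Complex.DeMoivre mult_ac)

lemma sum_nonneg_range:
  "(\<Sum>j\<in>nonneg_range N. poisson_coeff z j * cis (- (2 * pi * of_int j * t)))
    = (\<Sum>j\<le>N. (z * cnj (cis (2 * pi * t))) ^ j)"
  unfolding nonneg_range_def by (subst sum.reindex) (simp_all add: poisson_coeff_cis del: of_int_of_nat_eq)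

lemma sum_sym_range:
  "(\<Sum>j\<in>sym_range N. poisson_coeff z j * cis (- (2 * pi * of_int j * t)))
    = (\<Sum>j\<le>N. (z * cnj (cis (2 * pi * t))) ^ j) + cnj (\<Sum>j\<le>N. (z * cnj (cis (2 * pi * t))) ^ j) - 1"
proof -
  let ?f = "\<lambda>j. poisson_coeff z j * cis (- (2 * pi * of_int j * t))"
  let ?u = "z * cnj (cis (2 * pi * t))"
  have "sum ?f (sym_range N) = sum ?f (nonneg_range N) + sum ?f ((\<lambda>j. - int j) ` {1..N})"
    unfolding sym_range_def nonneg_range_def by (rule sum.union_disjoint) auto
  also have "sum ?f ((\<lambda>j. - int j) ` {1..N}) = (\<Sum>j\<in>{1..N}. cnj ?u ^ j)"
    by (subst sum.reindex) (auto simp: inj_on_def o_def intro!: sum.cong poisson_coeff_cis(2)[simplified])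
  also have "\<dots> = (\<Sum>j\<le>N. cnj ?u ^ j) - 1"
    using sum.atLeast_Suc_atMost[of 0 N "\<lambda>j. cnj ?u ^ j"] by (simp add: atMost_atLeast0)
  finally show ?thesis unfolding sum_nonneg_range by simp
qed

text \<open>Pairs, so that one uniform limit covers uniformity in z as well as in the angle;
  holomorphy in z will depend on the former.\<close>

definition kernel_region :: "real \<Rightarrow> ((complex^'n::finite) \<times> (real^'n)) set" where
  "kernel_region \<rho> = {(z, \<theta>). \<forall>k. cmod (z $ k) \<le> \<rho>}"

lemma uniform_limit_kernels:
  assumes "0 \<le> \<rho>" "\<rho> < 1"
  shows "uniform_limit (kernel_region \<rho> :: ((complex^'n::finite) \<times> (real^'n)) set) (\<lambda>N p. trunc_kernel (nonneg_range N) (fst p) (snd p))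
      (\<lambda>p. cnj (szk (fst p) (snd p))) sequentially" (is ?A)
    and "uniform_limit (kernel_region \<rho> :: ((complex^'n) \<times> (real^'n)) set) (\<lambda>N p. trunc_kernel (sym_range N) (fst p) (snd p))
      (\<lambda>p. poisson_kernel (fst p) (snd p)) sequentially" (is ?B)
proof -
  let ?S = "kernel_region \<rho> :: ((complex^'n) \<times> (real^'n)) set"
  define u where "u k p = fst p $ k * cnj (tpt (snd p) $ k)" for k and p :: "(complex^'n) \<times> (real^'n)"
  have u: "cmod (u k p) \<le> \<rho>" if "p \<in> ?S" for k p
    using that by (auto simp: u_def norm_mult kernel_region_def)
  have lim: "uniform_limit ?S (\<lambda>N p. \<Sum>j\<le>N. u k p ^ j) (\<lambda>p. inverse (1 - u k p)) sequentially" for k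
    by (rule uniform_limit_compose'[OF uniform_limit_geometric[OF assms(2,1)]]) (use u in auto)
  have inv: "cmod (inverse (1 - u k p)) \<le> inverse (1 - \<rho>)" if "p \<in> ?S" for k p
    using u[OF that, of k] norm_triangle_ineq2[of 1 "u k p"] assms
    by (simp add: norm_inverse le_imp_inverse_le)
  have limc: "uniform_limit ?S (\<lambda>N p. cnj (\<Sum>j\<le>N. u k p ^ j)) (\<lambda>p. cnj (inverse (1 - u k p))) sequentially" for k
    using lim[of k] unfolding uniform_limit_iff dist_norm complex_cnj_diff[symmetric] complex_mod_cnj .
  have lim2: "uniform_limit ?S (\<lambda>N p. (\<Sum>j\<le>N. u k p ^ j) + cnj (\<Sum>j\<le>N. u k p ^ j) - 1)
      (\<lambda>p. inverse (1 - u k p) + cnj (inverse (1 - u k p)) - 1) sequentially" for k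
    by (intro uniform_limit_add uniform_limit_minus lim limc uniform_limit_const)
  have "bounded ((\<lambda>p. inverse (1 - u k p)) ` ?S)" for k
    using inv unfolding bounded_iff by blast
  from uniform_limit_prod[OF finite[of "UNIV :: 'n set"], where S = ?S
      and f = "\<lambda>k N p. \<Sum>j\<le>N. u k p ^ j"
      and g = "\<lambda>k p. inverse (1 - u k p)", OF lim this]
  show ?A by (simp add: trunc_kernel_def sum_nonneg_range cnj_szk u_def tpt_def)
  have "cmod (inverse (1 - u k p) + cnj (inverse (1 - u k p)) - 1) \<le> 2 * inverse (1 - \<rho>) + 1" if "p \<in> ?S" for k p
    using inv[OF that, of k] norm_triangle_ineq4[of "inverse (1 - u k p) + cnj (inverse (1 - u k p))" 1]
      norm_triangle_ineq[of "inverse (1 - u k p)" "cnj (inverse (1 - u k p))"]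
    by (simp only: complex_mod_cnj norm_one)
  then have "bounded ((\<lambda>p. inverse (1 - u k p) + cnj (inverse (1 - u k p)) - 1) ` ?S)" for k
    unfolding bounded_iff by blast
  from uniform_limit_prod[OF finite[of "UNIV :: 'n set"], where S = ?S
      and f = "\<lambda>k N p. (\<Sum>j\<le>N. u k p ^ j) + cnj (\<Sum>j\<le>N. u k p ^ j) - 1"
      and g = "\<lambda>k p. inverse (1 - u k p) + cnj (inverse (1 - u k p)) - 1", OF lim2 this]
  show ?B by (simp add: trunc_kernel_def sum_sym_range poisson_kernel_def u_def tpt_def)
qed

text \<open>Finitely many coordinates have a maximal modulus below 1. A radius halfway between it
  and 1 makes the inequalities strict, leaving an open neighbourhood of z inside the polydisc of
  radius \<rho>.\<close>

lemma polydisc_radius: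
  assumes "z \<in> polydisc"
  obtains \<rho> where "0 \<le> \<rho>" "\<rho> < 1" "\<And>k. cmod (z $ k) < \<rho>"
proof -
  define M where "M = Max (range (\<lambda>k. cmod (z $ k)))"
  have "M < 1" unfolding M_def using assms by (subst Max_less_iff) (auto simp: polydisc_def)
  have le: "cmod (z $ k) \<le> M" for k unfolding M_def by (rule Max_ge) auto
  have "0 \<le> M" using le[of undefined] norm_ge_zero order_trans by blast
  show ?thesis
  proof (rule that[of "(1 + M) / 2"])
    show "cmod (z $ k) < (1 + M) / 2" for k using le[of k] \<open>M < 1\<close> by simp
  qed (use \<open>M < 1\<close> \<open>0 \<le> M\<close> in auto)
qed

lemma uniform_limit_kernels_at:
  assumes "z \<in> polydisc"
  shows "uniform_limit UNIV (\<lambda>N. trunc_kernel (nonneg_range N) z) (\<lambda>\<theta>. cnj (szk z \<theta>)) sequentially"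
    and "uniform_limit UNIV (\<lambda>N. trunc_kernel (sym_range N) z) (poisson_kernel z) sequentially"
proof -
  obtain \<rho> where \<rho>: "0 \<le> \<rho>" "\<rho> < 1" "\<And>k. cmod (z $ k) < \<rho>" using polydisc_radius[OF assms] by blast
  have "Pair z \<in> UNIV \<rightarrow> kernel_region \<rho>" using \<rho>(3) by (auto simp: kernel_region_def less_imp_le)
  from uniform_limit_compose'[OF uniform_limit_kernels(1)[OF \<rho>(1,2)] this]
    uniform_limit_compose'[OF uniform_limit_kernels(2)[OF \<rho>(1,2)] this]
  show "uniform_limit UNIV (\<lambda>N. trunc_kernel (nonneg_range N) z) (\<lambda>\<theta>. cnj (szk z \<theta>)) sequentially"
    "uniform_limit UNIV (\<lambda>N. trunc_kernel (sym_range N) z) (poisson_kernel z) sequentially"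
    by simp_all
qed

text \<open>Positivity in the form of an equation: the integral of the modulus then equals the
  integral of the kernel, which orthogonality of characters computes.\<close>

lemma poisson_kernel_nonneg:
  assumes "z \<in> polydisc"
  shows "of_real (cmod (poisson_kernel z \<theta>)) = poisson_kernel z \<theta>"
proof -
  have "\<exists>x\<ge>0. inverse (1 - u) + cnj (inverse (1 - u)) - 1 = of_real x" if "cmod u < 1" for u
  proof (intro exI conjI)
    have nz: "1 - u \<noteq> 0" "1 - cnj u \<noteq> 0" using one_minus_neq_0[of u] one_minus_neq_0[of "cnj u"] that by auto
    have "inverse a + inverse b - 1 = (a + b - a * b) / (a * b)" if "a \<noteq> 0" "b \<noteq> 0" for a b :: complex
      using that by (simp add: field_simps)
    from this[OF nz]
    have "inverse (1 - u) + cnj (inverse (1 - u)) - 1 = (1 - u * cnj u) / ((1 - u) * (1 - cnj u))"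
      by (simp add: algebra_simps)
    also have "\<dots> = (1 - of_real ((cmod u)\<^sup>2)) / of_real ((cmod (1 - u))\<^sup>2)"
      unfolding complex_norm_square by simp
    also have "\<dots> = of_real ((1 - (cmod u)\<^sup>2) / (cmod (1 - u))\<^sup>2)" by simp
    finally show "inverse (1 - u) + cnj (inverse (1 - u)) - 1 = of_real ((1 - (cmod u)\<^sup>2) / (cmod (1 - u))\<^sup>2)" .
    show "0 \<le> (1 - (cmod u)\<^sup>2) / (cmod (1 - u))\<^sup>2"
      using that by (simp add: power_le_one)
  qed
  then obtain x where x: "\<And>u. cmod u < 1 \<Longrightarrow> 0 \<le> x u \<and> inverse (1 - u) + cnj (inverse (1 - u)) - 1 = of_real (x u)"
    by metis
  have "poisson_kernel z \<theta> = of_real (\<Prod>k\<in>UNIV. x (z $ k * cnj (tpt \<theta> $ k)))"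
    unfolding poisson_kernel_def of_real_prod
    using x[OF polydisc_times_tpt[OF assms]] by (intro prod.cong) blast+
  moreover have "0 \<le> (\<Prod>k\<in>UNIV. x (z $ k * cnj (tpt \<theta> $ k)))"
    using x[OF polydisc_times_tpt[OF assms]] by (intro prod_nonneg) blast
  ultimately show ?thesis by (simp del: of_real_prod)
qed

lemma finite_ranges [simp]: "finite (nonneg_range N)" "finite (sym_range N)"
  by (auto simp: nonneg_range_def sym_range_def)

lemma integral_char_trunc_kernel:
  assumes "finite J" "\<forall>k. \<beta> k \<in> J"
  shows "(\<integral>\<theta>. trunc_kernel J z \<theta> * torus_char \<beta> \<theta> \<partial>tmeas) = (\<Prod>k\<in>UNIV. poisson_coeff (z $ k) (\<beta> k))"
proof -
  let ?C = "\<lambda>\<alpha>. \<Prod>k\<in>UNIV. poisson_coeff (z $ k) (\<alpha> k)"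
  have "(\<integral>\<theta>. trunc_kernel J z \<theta> * torus_char \<beta> \<theta> \<partial>tmeas)
      = (\<integral>\<theta>. (\<Sum>\<alpha>\<in>PiE UNIV (\<lambda>_. J). ?C \<alpha> * torus_char (\<lambda>k. - \<alpha> k + \<beta> k) \<theta>) \<partial>tmeas)"
    by (simp add: trunc_kernel_expand[OF assms(1)] sum_distrib_right mult.assoc torus_char_mult)
  also have "\<dots> = (\<Sum>\<alpha>\<in>PiE UNIV (\<lambda>_. J). ?C \<alpha> * integral\<^sup>L tmeas (torus_char (\<lambda>k. - \<alpha> k + \<beta> k)))"
    by (subst Bochner_Integration.integral_sum)
       (auto intro!: continuous_integrable_tmeas continuous_intros)
  also have "\<dots> = (\<Sum>\<alpha>\<in>PiE UNIV (\<lambda>_. J). if \<alpha> = \<beta> then ?C \<alpha> else 0)"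
    by (intro sum.cong refl) (auto simp: integral_torus_char fun_eq_iff)
  also have "\<dots> = ?C \<beta>"
  proof -
    have "finite (PiE (UNIV :: 'a set) (\<lambda>_. J))" "\<beta> \<in> PiE UNIV (\<lambda>_. J)"
      using assms by (auto intro: finite_PiE)
    then show ?thesis by simp
  qed
  finally show ?thesis .
qed

lemma continuous_poisson_kernel:
  assumes "z \<in> polydisc" shows "continuous_on UNIV (poisson_kernel z)"
  by (rule uniform_limit_theorem[OF _ uniform_limit_kernels_at(2)[OF assms]])
     (auto intro!: always_eventually continuous_intros)

text \<open>By positivity this is the Fourier coefficient at frequency 0, which equals 1 already for
  every truncation.\<close>

lemma integral_norm_poisson_kernel:
  assumes z: "z \<in> polydisc"
  shows "(\<integral>\<theta>. cmod (poisson_kernel z \<theta>) \<partial>tmeas) = 1"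
proof -
  have "(\<lambda>N. \<integral>\<theta>. trunc_kernel (sym_range N) z \<theta> * torus_char (\<lambda>_. 0) \<theta> \<partial>tmeas)
      \<longlonglongrightarrow> (\<integral>\<theta>. poisson_kernel z \<theta> * torus_char (\<lambda>_. 0) \<theta> \<partial>tmeas)"
    by (intro uniform_limit_integral_tmeas uniform_limit_kernels_at z continuous_intros
        continuous_integrable_tmeas)
  moreover have "(\<integral>\<theta>. trunc_kernel (sym_range N) z \<theta> * torus_char (\<lambda>_. 0) \<theta> \<partial>tmeas) = 1" for N
    by (subst integral_char_trunc_kernel) (auto simp: sym_range_def poisson_coeff_def image_iff)
  ultimately have "(\<integral>\<theta>. poisson_kernel z \<theta> \<partial>tmeas) = 1"
    by (simp add: LIMSEQ_const_iff)
  moreover have "(\<integral>\<theta>. poisson_kernel z \<theta> \<partial>tmeas) = of_real (\<integral>\<theta>. cmod (poisson_kernel z \<theta>) \<partial>tmeas)"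
    using poisson_kernel_nonneg[OF z]
    by (subst integral_complex_of_real[symmetric]) (intro Bochner_Integration.integral_cong, auto)
  ultimately have "complex_of_real (\<integral>\<theta>. cmod (poisson_kernel z \<theta>) \<partial>tmeas) = 1" by simp
  then show ?thesis by (simp only: of_real_eq_1_iff)
qed

text \<open>The pairing carries no conjugate on the polynomial, so a monomial of exponent \<alpha>
  reads off the Fourier coefficient at - \<alpha> of the other factor. There the conjugate Szego
  kernel has the monomial evaluated at z, while \<open>Mn\<close> and \<open>H2_0\<close> have
  0.\<close>

lemma integral_polyfun:
  assumes "polyfun p"
  shows "z \<in> polydisc \<Longrightarrow> (\<integral>\<theta>. p (tpt \<theta>) * cnj (szk z \<theta>) \<partial>tmeas) = p z"
    and "b \<in> Mn \<Longrightarrow> (\<integral>\<theta>. p (tpt \<theta>) * b \<theta> \<partial>tmeas) = 0"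
    and "c \<in> H2_0 \<Longrightarrow> (\<integral>\<theta>. p (tpt \<theta>) * c \<theta> \<partial>tmeas) = 0"
    and "continuous_on UNIV (\<lambda>\<theta>. p (tpt \<theta>))"
proof -
  have cont: "continuous_on UNIV (\<lambda>\<theta>. p (tpt \<theta>))" if "polyfun p" for p :: "complex^'a \<Rightarrow> complex"
    using that by induction (auto intro!: continuous_intros)
  then show "continuous_on UNIV (\<lambda>\<theta>. p (tpt \<theta>))" using assms .
  have pairing_add: "(\<integral>\<theta>. (f (tpt \<theta>) + g (tpt \<theta>)) * u \<theta> \<partial>tmeas)
      = (\<integral>\<theta>. f (tpt \<theta>) * u \<theta> \<partial>tmeas) + (\<integral>\<theta>. g (tpt \<theta>) * u \<theta> \<partial>tmeas)"
    if "polyfun f" "polyfun g" "integrable tmeas u" for f g :: "complex^'a \<Rightarrow> complex" and u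
    using integrable_continuous_mult[OF cont[OF that(1)] that(3)]
      integrable_continuous_mult[OF cont[OF that(2)] that(3)] by (simp add: distrib_right)
  show "(\<integral>\<theta>. p (tpt \<theta>) * b \<theta> \<partial>tmeas) = 0" if b: "b \<in> Mn"
    using assms
  proof induction
    case (monom d \<alpha>)
    then show ?case using integral_char_Mn[OF b, of "\<lambda>k. int (\<alpha> k)"] by (simp add: tpt_power_prod mult.assoc)
  next
    case (add f g)
    have "integrable tmeas b" using b Mn_subset_L2 L2_integrable by blast
    then show ?case using add pairing_add[of f g b] by simp
  qed
  show "(\<integral>\<theta>. p (tpt \<theta>) * c \<theta> \<partial>tmeas) = 0" if c: "c \<in> H2_0"
    using assms
  proof induction
    case (monom d \<alpha>)
    then show ?case using integral_char_H2_0[OF c, of "\<lambda>k. int (\<alpha> k)"] by (simp add: tpt_power_prod mult.assoc)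
  next
    case (add f g)
    have "integrable tmeas c" using c H2_0_subset_H2 H2_subset_L2 L2_integrable by blast
    then show ?case using add pairing_add[of f g c] by simp
  qed
  show "(\<integral>\<theta>. p (tpt \<theta>) * cnj (szk z \<theta>) \<partial>tmeas) = p z" if z: "z \<in> polydisc"
    using assms
  proof induction
    case (monom d \<alpha>)
    let ?\<beta> = "\<lambda>k. int (\<alpha> k)"
    have "(\<lambda>N. \<integral>\<theta>. trunc_kernel (nonneg_range N) z \<theta> * torus_char ?\<beta> \<theta> \<partial>tmeas)
        \<longlonglongrightarrow> (\<integral>\<theta>. cnj (szk z \<theta>) * torus_char ?\<beta> \<theta> \<partial>tmeas)"
      by (intro uniform_limit_integral_tmeas uniform_limit_kernels_at z continuous_intros
          continuous_integrable_tmeas)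
    moreover have "\<forall>\<^sub>F N in sequentially.
        (\<integral>\<theta>. trunc_kernel (nonneg_range N) z \<theta> * torus_char ?\<beta> \<theta> \<partial>tmeas) = (\<Prod>k\<in>UNIV. (z $ k) ^ \<alpha> k)"
      \<comment> \<open>As soon as N exceeds all exponents, the truncation contains the frequency in
        question and the integral no longer changes.\<close>
      using eventually_ge_at_top[of "Max (range \<alpha>)"]
    proof eventually_elim
      case (elim N)
      then have "\<forall>k. ?\<beta> k \<in> nonneg_range N" by (auto simp: nonneg_range_def)
      then show ?case by (subst integral_char_trunc_kernel) (auto simp: poisson_coeff_def)
    qed
    ultimately have "(\<integral>\<theta>. cnj (szk z \<theta>) * torus_char ?\<beta> \<theta> \<partial>tmeas) = (\<Prod>k\<in>UNIV. (z $ k) ^ \<alpha> k)"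
      by (rule LIMSEQ_unique[OF _ tendsto_eventually])
    then show ?case by (simp add: tpt_power_prod mult_ac)
  next
    case (add f g)
    have "integrable tmeas (\<lambda>\<theta>. cnj (szk z \<theta>))"
      by (intro continuous_integrable_tmeas continuous_cnj_szk z)
    then show ?case using add pairing_add[of f g "\<lambda>\<theta>. cnj (szk z \<theta>)"] by simp
  qed
qed

section \<open>Contractive functionals on integrable functions\<close>

text \<open>The Hahn-Banach theorem above speaks of a vector space given as a type. Functions equal
  almost everywhere stay distinct, since the distance enters only as a sublinear functional, which
  may vanish at nonzero points.\<close>

typedef ('n::finite) torus_L1 = "{f :: real^'n \<Rightarrow> complex. integrable tmeas f}"
  morphisms L1_fun Abs_torus_L1
  by (rule exI[of _ "\<lambda>_. 0"]) simp

setup_lifting type_definition_torus_L1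

instantiation torus_L1 :: (finite) real_vector
begin

lift_definition zero_torus_L1 :: "'a torus_L1" is "\<lambda>_. 0" by simp
lift_definition plus_torus_L1 :: "'a torus_L1 \<Rightarrow> 'a torus_L1 \<Rightarrow> 'a torus_L1"
  is "\<lambda>f g \<theta>. f \<theta> + g \<theta>" by simp
lift_definition minus_torus_L1 :: "'a torus_L1 \<Rightarrow> 'a torus_L1 \<Rightarrow> 'a torus_L1"
  is "\<lambda>f g \<theta>. f \<theta> - g \<theta>" by simp
lift_definition uminus_torus_L1 :: "'a torus_L1 \<Rightarrow> 'a torus_L1"
  is "\<lambda>f \<theta>. - f \<theta>" by simp
lift_definition scaleR_torus_L1 :: "real \<Rightarrow> 'a torus_L1 \<Rightarrow> 'a torus_L1"
  is "\<lambda>r f \<theta>. r *\<^sub>R f \<theta>" by simp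

instance
  by standard (transfer; simp add: fun_eq_iff algebra_simps)+

end

text \<open>The type is a real vector space, so multiplication by complex scalars is added as a
  separate operation from which complex linearity is recovered.\<close>

lift_definition cscale :: "complex \<Rightarrow> 'n::finite torus_L1 \<Rightarrow> 'n torus_L1"
  is "\<lambda>c f \<theta>. c * f \<theta>" by simp

lemma cscale_of_real: "cscale (of_real r) x = r *\<^sub>R x"
  by transfer (simp add: fun_eq_iff scaleR_conv_of_real)

lemma cscale_cscale: "cscale c (cscale d x) = cscale (c * d) x"
  by transfer (simp add: fun_eq_iff mult.assoc)

lemma cscale_add: "cscale c (x + y) = cscale c x + cscale c y"
  by transfer (simp add: fun_eq_iff distrib_left)

lemma cscale_Re_Im: "cscale c x = Re c *\<^sub>R x + Im c *\<^sub>R cscale \<i> x"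
  by transfer (auto simp: fun_eq_iff complex_eq_iff)

lemma L1_fun_integrable: "integrable tmeas (L1_fun x)"
  using L1_fun by blast

lemma L1_fun_Abs: "integrable tmeas f \<Longrightarrow> L1_fun (Abs_torus_L1 f) = f"
  by (simp add: Abs_torus_L1_inverse)

definition L1_contraction :: "((real^'n::finite \<Rightarrow> complex) \<Rightarrow> complex) \<Rightarrow> bool" where
  "L1_contraction \<Lambda> \<longleftrightarrow>
    (\<forall>f g. integrable tmeas f \<longrightarrow> integrable tmeas g \<longrightarrow> \<Lambda> (\<lambda>\<theta>. f \<theta> + g \<theta>) = \<Lambda> f + \<Lambda> g) \<and>
    (\<forall>c f. integrable tmeas f \<longrightarrow> \<Lambda> (\<lambda>\<theta>. c * f \<theta>) = c * \<Lambda> f) \<and>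
    (\<forall>f. integrable tmeas f \<longrightarrow> cmod (\<Lambda> f) \<le> (\<integral>\<theta>. cmod (f \<theta>) \<partial>tmeas))"

section \<open>The distance to a subspace as a sublinear functional\<close>

definition L1_dist :: "(real^'n::finite \<Rightarrow> complex) set \<Rightarrow> 'n torus_L1 \<Rightarrow> real" where
  "L1_dist M x = (INF h\<in>M. \<integral>\<theta>. cmod (L1_fun x \<theta> - h \<theta>) \<partial>tmeas)"

lemma L1_dist_le: "h \<in> M \<Longrightarrow> L1_dist M x \<le> (\<integral>\<theta>. cmod (L1_fun x \<theta> - h \<theta>) \<partial>tmeas)"
  unfolding L1_dist_def by (rule cINF_lower) (auto intro!: bdd_belowI2[of _ 0])

lemma L1_dist_greatest:
  "M \<noteq> {} \<Longrightarrow> (\<And>h. h \<in> M \<Longrightarrow> b \<le> (\<integral>\<theta>. cmod (L1_fun x \<theta> - h \<theta>) \<partial>tmeas)) \<Longrightarrow> b \<le> L1_dist M x"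
  unfolding L1_dist_def by (rule cINF_greatest)

lemma L1_dist_add:
  assumes M: "\<And>h. h \<in> M \<Longrightarrow> integrable tmeas h" "M \<noteq> {}"
    and add: "\<And>h k. h \<in> M \<Longrightarrow> k \<in> M \<Longrightarrow> (\<lambda>\<theta>. h \<theta> + k \<theta>) \<in> M"
  shows "L1_dist M (x + y) \<le> L1_dist M x + L1_dist M y"
proof -
  let ?d = "\<lambda>x h. \<integral>\<theta>. cmod (L1_fun x \<theta> - h \<theta>) \<partial>tmeas"
  have *: "L1_dist M (x + y) \<le> ?d x h + ?d y k" if "h \<in> M" "k \<in> M" for h k
  proof -
    have "L1_dist M (x + y) \<le> (\<integral>\<theta>. cmod ((L1_fun x \<theta> - h \<theta>) + (L1_fun y \<theta> - k \<theta>)) \<partial>tmeas)"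
      using L1_dist_le[OF add[OF that], of "x + y"] by (simp add: plus_torus_L1.rep_eq algebra_simps)
    also have "\<dots> \<le> (\<integral>\<theta>. cmod (L1_fun x \<theta> - h \<theta>) + cmod (L1_fun y \<theta> - k \<theta>) \<partial>tmeas)"
      by (intro integral_mono norm_triangle_ineq Bochner_Integration.integrable_add integrable_norm
          Bochner_Integration.integrable_diff L1_fun_integrable M that)
    also have "\<dots> = ?d x h + ?d y k"
      by (intro Bochner_Integration.integral_add integrable_norm
          Bochner_Integration.integrable_diff L1_fun_integrable M that)
    finally show ?thesis .
  qed
  have "L1_dist M (x + y) - ?d y k \<le> L1_dist M x" if "k \<in> M" for k
    by (rule L1_dist_greatest[OF M(2)]) (use *[OF _ that] in \<open>simp add: algebra_simps\<close>)
  then have "L1_dist M (x + y) - L1_dist M x \<le> L1_dist M y"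
    by (intro L1_dist_greatest[OF M(2)]) (simp add: algebra_simps)
  then show ?thesis by simp
qed

lemma L1_dist_cscale:
  assumes M: "M \<noteq> {}" and cmult: "\<And>c h. h \<in> M \<Longrightarrow> (\<lambda>\<theta>. c * h \<theta>) \<in> M"
  shows "L1_dist M (cscale c x) \<le> cmod c * L1_dist M x"
proof -
  let ?d = "\<lambda>x h. \<integral>\<theta>. cmod (L1_fun x \<theta> - h \<theta>) \<partial>tmeas"
  have *: "L1_dist M (cscale c x) \<le> cmod c * ?d x h" if "h \<in> M" for h
    using L1_dist_le[OF cmult[OF that], of "cscale c x" c]
    by (simp add: cscale.rep_eq norm_mult flip: right_diff_distrib)
  show ?thesis
  proof (cases "c = 0")
    case True
    then show ?thesis using * M by auto
  next
    case False
    have "L1_dist M (cscale c x) / cmod c \<le> L1_dist M x"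
      by (rule L1_dist_greatest[OF M]) (use * False in \<open>simp add: field_simps\<close>)
    then show ?thesis using False by (simp add: field_simps)
  qed
qed

text \<open>Hahn-Banach is applied to the distance from M itself. A functional below it vanishes on
  M, where the distance is 0, and is a contraction, because 0 lies in M.\<close>

theorem L1_separation:
  fixes g :: "real^'n::finite \<Rightarrow> complex"
  assumes M: "\<And>h. h \<in> M \<Longrightarrow> integrable tmeas h" "M \<noteq> {}"
    and add: "\<And>h k. h \<in> M \<Longrightarrow> k \<in> M \<Longrightarrow> (\<lambda>\<theta>. h \<theta> + k \<theta>) \<in> M"
    and cmult: "\<And>c h. h \<in> M \<Longrightarrow> (\<lambda>\<theta>. c * h \<theta>) \<in> M"
    and g: "integrable tmeas g" and dist: "dist_L1 g M \<ge> 1"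
  shows "\<exists>\<Lambda>. L1_contraction \<Lambda> \<and> \<Lambda> g = 1 \<and> (\<forall>h\<in>M. \<Lambda> h = 0)"
proof -
  let ?p = "L1_dist M"
  have pc: "?p (cscale c x) \<le> cmod c * ?p x" for c x
    by (rule L1_dist_cscale[OF M(2) cmult])
  have sub: "sublinear ?p"
  proof (rule sublinearI)
    show "?p (x + y) \<le> ?p x + ?p y" for x y by (rule L1_dist_add[OF M add])
    show "?p (c *\<^sub>R x) \<le> c * ?p x" if "0 \<le> c" for c x
      using pc[of "of_real c" x] that by (simp add: cscale_of_real)
  qed
  define G where "G = Abs_torus_L1 g"
  have G: "L1_fun G = g" by (simp add: G_def L1_fun_Abs g)
  obtain f where f: "linear f" "\<And>x. f x \<le> ?p x" "f G = ?p G"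
    using hahn_banach_attained[OF sub, of G thesis] by blast
  define d where "d = ?p G"
  have d: "d \<ge> 1"
    unfolding d_def
  proof (rule L1_dist_greatest[OF M(2)])
    fix h assume h: "h \<in> M"
    have int: "integrable tmeas (\<lambda>\<theta>. g \<theta> - h \<theta>)" using g M(1)[OF h] by simp
    have "1 \<le> l1norm (\<lambda>\<theta>. g \<theta> - h \<theta>)"
      using dist INF_lower[OF h, of "\<lambda>h. l1norm (\<lambda>\<theta>. g \<theta> - h \<theta>)"] order_trans
      unfolding dist_L1_def by blast
    also have "\<dots> = ennreal (\<integral>\<theta>. cmod (g \<theta> - h \<theta>) \<partial>tmeas)"
      unfolding l1norm_def by (rule nn_integral_eq_integral) (use int in auto)
    finally show "1 \<le> (\<integral>\<theta>. cmod (L1_fun G \<theta> - h \<theta>) \<partial>tmeas)" by (simp add: G)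
  qed
  \<comment> \<open>The usual complexification: L x = f x - i f (i x) is complex linear and has real
    part f.\<close>
  define L where "L x = Complex (f x) (- f (cscale \<i> x))" for x
  have Ladd: "L (x + y) = L x + L y" for x y
    by (simp add: L_def cscale_add linear_add[OF f(1)] complex_eq_iff)
  have fc: "f (cscale c x) = Re c * f x + Im c * f (cscale \<i> x)" for c x
    by (subst cscale_Re_Im) (simp add: linear_add[OF f(1)] linear_cmul[OF f(1)])
  have Lc: "L (cscale c x) = c * L x" for c x
    by (simp add: L_def fc[of c x] cscale_cscale fc[of "\<i> * c" x] complex_eq_iff)
  have Lp: "cmod (L x) \<le> ?p x" for x
  proof (cases "L x = 0")
    case True
    have "0 \<le> ?p x" by (rule L1_dist_greatest[OF M(2)]) simp
    then show ?thesis using True by simp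
  next
    case False
    \<comment> \<open>Rotation by this unimodular scalar makes the value of L real and nonnegative,
      so the bound on its real part f becomes a bound on its modulus.\<close>
    define c where "c = cnj (L x) / of_real (cmod (L x))"
    have c1: "cmod c = 1" using False by (simp add: c_def norm_divide)
    have "L (cscale c x) = (L x * cnj (L x)) / of_real (cmod (L x))"
      by (simp add: Lc c_def)
    also have "\<dots> = of_real (cmod (L x))"
      using False by (simp add: complex_norm_square[symmetric] power2_eq_square)
    finally have "Re (L (cscale c x)) = cmod (L x)" by simp
    then have "cmod (L x) = f (cscale c x)" by (simp add: L_def)
    also have "\<dots> \<le> ?p x" using f(2)[of "cscale c x"] pc[of c x] c1 by simp
    finally show ?thesis .
  qed
  \<comment> \<open>The real part already attains the bound d on the modulus, which leaves no room
    for an imaginary part.\<close>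
  have LG: "L G = of_real d"
  proof -
    have Re: "Re (L G) = d" by (simp add: L_def f(3) d_def)
    have "(cmod (L G))\<^sup>2 \<le> d\<^sup>2" using Lp[of G] by (intro power_mono) (auto simp: d_def)
    then have "Im (L G) = 0" using Re by (simp add: cmod_power2)
    with Re show ?thesis by (simp add: complex_eq_iff)
  qed
  \<comment> \<open>The distance of g may exceed 1. Division by it normalizes the value at g, and as
    d is at least 1 the bound is only improved.\<close>
  define \<Lambda> where "\<Lambda> h = L (Abs_torus_L1 h) / of_real d" for h
  have \<Lambda>p: "cmod (\<Lambda> h) \<le> ?p (Abs_torus_L1 h)" for h
  proof -
    have "cmod (L (Abs_torus_L1 h)) \<le> ?p (Abs_torus_L1 h) * 1" using Lp by simp
    also have "\<dots> \<le> ?p (Abs_torus_L1 h) * d"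
      using d Lp[of "Abs_torus_L1 h"] order_trans[OF norm_ge_zero] by (intro mult_left_mono) auto
    finally show ?thesis using d by (simp add: \<Lambda>_def norm_divide field_simps)
  qed
  have "L1_contraction \<Lambda>"
    unfolding L1_contraction_def
  proof (intro conjI allI impI)
    fix h k :: "real^'n \<Rightarrow> complex" and c
    assume h: "integrable tmeas h"
    have "Abs_torus_L1 (\<lambda>\<theta>. c * h \<theta>) = cscale c (Abs_torus_L1 h)"
      using h by (simp add: cscale.abs_eq eq_onp_same_args)
    then show "\<Lambda> (\<lambda>\<theta>. c * h \<theta>) = c * \<Lambda> h" by (simp add: \<Lambda>_def Lc)
    obtain m where "m \<in> M" using M(2) by auto
    then have "(\<lambda>_. 0) \<in> M" using cmult[of m 0] by simp
    then have "?p (Abs_torus_L1 h) \<le> (\<integral>\<theta>. cmod (h \<theta>) \<partial>tmeas)"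
      using L1_dist_le[of "\<lambda>_. 0" M "Abs_torus_L1 h"] by (simp add: L1_fun_Abs h)
    then show "cmod (\<Lambda> h) \<le> (\<integral>\<theta>. cmod (h \<theta>) \<partial>tmeas)" using \<Lambda>p[of h] by simp
    assume k: "integrable tmeas k"
    have "Abs_torus_L1 (\<lambda>\<theta>. h \<theta> + k \<theta>) = Abs_torus_L1 h + Abs_torus_L1 k"
      using h k by (simp add: plus_torus_L1.abs_eq eq_onp_same_args)
    then show "\<Lambda> (\<lambda>\<theta>. h \<theta> + k \<theta>) = \<Lambda> h + \<Lambda> k" by (simp add: \<Lambda>_def Ladd add_divide_distrib)
  qed
  moreover have "\<Lambda> g = 1" using LG d by (simp add: \<Lambda>_def flip: G_def)
  moreover have "\<Lambda> h = 0" if "h \<in> M" for h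
  proof -
    have "?p (Abs_torus_L1 h) \<le> 0"
      using L1_dist_le[OF that, of "Abs_torus_L1 h"] by (simp add: L1_fun_Abs M(1)[OF that])
    then have "cmod (\<Lambda> h) \<le> 0" using \<Lambda>p[of h] by (rule order_trans[rotated])
    then show ?thesis by simp
  qed
  ultimately show ?thesis by blast
qed

section \<open>From functionals to the Schur class\<close>

lemma L1_contraction_add:
    "L1_contraction \<Lambda> \<Longrightarrow> integrable tmeas f \<Longrightarrow> integrable tmeas g \<Longrightarrow> \<Lambda> (\<lambda>\<theta>. f \<theta> + g \<theta>) = \<Lambda> f + \<Lambda> g"
  and L1_contraction_cmult: "L1_contraction \<Lambda> \<Longrightarrow> integrable tmeas f \<Longrightarrow> \<Lambda> (\<lambda>\<theta>. c * f \<theta>) = c * \<Lambda> f"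
  and L1_contraction_norm: "L1_contraction \<Lambda> \<Longrightarrow> integrable tmeas f \<Longrightarrow> cmod (\<Lambda> f) \<le> (\<integral>\<theta>. cmod (f \<theta>) \<partial>tmeas)"
  unfolding L1_contraction_def by blast+

lemma L1_contraction_sum:
  assumes \<Lambda>: "L1_contraction \<Lambda>" and "finite A" "\<And>a. a \<in> A \<Longrightarrow> integrable tmeas (f a)"
  shows "\<Lambda> (\<lambda>\<theta>. \<Sum>a\<in>A. f a \<theta>) = (\<Sum>a\<in>A. \<Lambda> (f a))"
  using assms(2,3)
proof (induction A rule: finite_induct)
  case empty
  show ?case using L1_contraction_cmult[OF \<Lambda>, of "\<lambda>_. 0" 0] by simp
next
  case (insert a A)
  then have "integrable tmeas (f a)" "integrable tmeas (\<lambda>\<theta>. \<Sum>a\<in>A. f a \<theta>)" by auto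
  from L1_contraction_add[OF \<Lambda> this] insert show ?case by simp
qed

lemma L1_contraction_diff_le:
  fixes f g :: "real^'n::finite \<Rightarrow> complex"
  assumes \<Lambda>: "L1_contraction \<Lambda>" and f: "integrable tmeas f" and g: "integrable tmeas g"
    and e: "\<And>\<theta>. cmod (f \<theta> - g \<theta>) \<le> e"
  shows "cmod (\<Lambda> f - \<Lambda> g) \<le> e"
proof -
  have "\<Lambda> f - \<Lambda> g = \<Lambda> (\<lambda>\<theta>. f \<theta> - g \<theta>)"
    using L1_contraction_add[OF \<Lambda> f, of "\<lambda>\<theta>. - 1 * g \<theta>"] L1_contraction_cmult[OF \<Lambda> g, of "- 1"] g by simp
  also have "cmod \<dots> \<le> (\<integral>\<theta>. cmod (f \<theta> - g \<theta>) \<partial>tmeas)"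
    using f g by (intro L1_contraction_norm[OF \<Lambda>]) simp
  also have "\<dots> \<le> (\<integral>\<theta>. e \<partial>(tmeas :: (real^'n) measure))"
    by (rule Bochner_Integration.integral_mono) (use f g e in auto)
  also have "\<dots> = e" by (simp add: measure_def emeasure_space_tmeas)
  finally show ?thesis .
qed

lemma L1_contraction_trunc_kernel:
  fixes z :: "complex^'n::finite"
  assumes \<Lambda>: "L1_contraction \<Lambda>" and J: "finite J"
  shows "\<Lambda> (trunc_kernel J z)
    = (\<Sum>\<alpha>\<in>PiE UNIV (\<lambda>_. J). \<Lambda> (torus_char (\<lambda>k. - \<alpha> k)) * (\<Prod>k\<in>UNIV. poisson_coeff (z $ k) (\<alpha> k)))"
proof -
  have int: "integrable tmeas (torus_char \<alpha>)" for \<alpha> :: "'n \<Rightarrow> int"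
    by (intro continuous_integrable_tmeas continuous_intros)
  have "\<Lambda> (trunc_kernel J z) = \<Lambda> (\<lambda>\<theta>. \<Sum>\<alpha>\<in>PiE UNIV (\<lambda>_. J).
      (\<Prod>k\<in>UNIV. poisson_coeff (z $ k) (\<alpha> k)) * torus_char (\<lambda>k. - \<alpha> k) \<theta>)"
    by (intro arg_cong[where f = \<Lambda>] ext trunc_kernel_expand J)
  also have "\<dots> = (\<Sum>\<alpha>\<in>PiE UNIV (\<lambda>_. J).
      \<Lambda> (\<lambda>\<theta>. (\<Prod>k\<in>UNIV. poisson_coeff (z $ k) (\<alpha> k)) * torus_char (\<lambda>k. - \<alpha> k) \<theta>))"
    by (rule L1_contraction_sum[OF \<Lambda>]) (auto intro!: finite_PiE J int)
  finally show ?thesis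
    unfolding L1_contraction_cmult[OF \<Lambda> int] by (simp add: mult.commute)
qed

text \<open>Characters whose frequency is not in the negative orthant are annihilated, so passing from
  the symmetric to the one-sided range does not change the value.\<close>

lemma L1_contraction_sym_range:
  fixes z :: "complex^'n::finite"
  assumes \<Lambda>: "L1_contraction \<Lambda>" and Mn: "\<forall>h\<in>Mn. \<Lambda> h = 0" and H2_0: "\<forall>h\<in>H2_0. \<Lambda> h = 0"
  shows "\<Lambda> (trunc_kernel (sym_range N) z) = \<Lambda> (trunc_kernel (nonneg_range N) z)"
  unfolding L1_contraction_trunc_kernel[OF \<Lambda> finite_ranges(1)] L1_contraction_trunc_kernel[OF \<Lambda> finite_ranges(2)]
proof (rule sum.mono_neutral_right)
  show "finite (PiE (UNIV :: 'n set) (\<lambda>_. sym_range N))" by (intro finite_PiE) auto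
  show "PiE (UNIV :: 'n set) (\<lambda>_. nonneg_range N) \<subseteq> PiE UNIV (\<lambda>_. sym_range N)"
    by (intro PiE_mono) (auto simp: nonneg_range_def sym_range_def)
  have "\<Lambda> (torus_char (\<lambda>k. - \<alpha> k)) = 0"
    if \<alpha>: "\<alpha> \<in> PiE (UNIV :: 'n set) (\<lambda>_. sym_range N) - PiE UNIV (\<lambda>_. nonneg_range N)" for \<alpha>
  proof -
    obtain k where k: "\<alpha> k \<in> sym_range N" "\<alpha> k \<notin> nonneg_range N" using \<alpha> by (auto simp: PiE_UNIV_domain)
    then have "\<alpha> k < 0" by (auto simp: sym_range_def nonneg_range_def)
    show ?thesis
    proof (cases "\<exists>i. \<alpha> i > 0")
      case True
      then obtain i where "\<alpha> i > 0" by blast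
      then have "torus_char (\<lambda>k. - \<alpha> k) \<in> Mn"
        using \<open>\<alpha> k < 0\<close> torus_char_Mn[of "\<lambda>k. - \<alpha> k" i k] by simp
      then show ?thesis using Mn by blast
    next
      case False
      have "(\<lambda>k. - \<alpha> k) \<noteq> (\<lambda>_. 0)"
      proof
        assume "(\<lambda>k. - \<alpha> k) = (\<lambda>_. 0)"
        from fun_cong[OF this, of k] show False using \<open>\<alpha> k < 0\<close> by simp
      qed
      then have "torus_char (\<lambda>k. - \<alpha> k) \<in> H2_0"
        using False by (intro torus_char_H2_0) (auto simp: not_less)
      then show ?thesis using H2_0 by blast
    qed
  qed
  then show "\<forall>\<alpha>\<in>PiE UNIV (\<lambda>_. sym_range N) - PiE UNIV (\<lambda>_. nonneg_range N).
      \<Lambda> (torus_char (\<lambda>k. - \<alpha> k)) * (\<Prod>k\<in>UNIV. poisson_coeff (z $ k) (\<alpha> k)) = 0"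
    by simp
qed

text \<open>On nonnegative frequencies the coefficients are powers of z without conjugates; this is
  the source of holomorphy in z.\<close>

lemma polyfun_contraction_trunc_kernel:
  assumes \<Lambda>: "L1_contraction \<Lambda>"
  shows "polyfun (\<lambda>z. \<Lambda> (trunc_kernel (nonneg_range N) z))"
proof -
  have "polyfun (\<lambda>z :: complex^'a. \<Sum>\<alpha>\<in>PiE UNIV (\<lambda>_. nonneg_range N).
      \<Lambda> (torus_char (\<lambda>k. - \<alpha> k)) * (\<Prod>k\<in>UNIV. (z $ k) ^ nat (\<alpha> k)))"
    by (intro polyfun_sum finite_PiE polyfun.monom) auto
  also have "(\<lambda>z :: complex^'a. \<Sum>\<alpha>\<in>PiE UNIV (\<lambda>_. nonneg_range N).
      \<Lambda> (torus_char (\<lambda>k. - \<alpha> k)) * (\<Prod>k\<in>UNIV. (z $ k) ^ nat (\<alpha> k)))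
      = (\<lambda>z. \<Lambda> (trunc_kernel (nonneg_range N) z))"
  proof (rule ext)
    fix z :: "complex^'a"
    show "(\<Sum>\<alpha>\<in>PiE UNIV (\<lambda>_. nonneg_range N).
      \<Lambda> (torus_char (\<lambda>k. - \<alpha> k)) * (\<Prod>k\<in>UNIV. (z $ k) ^ nat (\<alpha> k))) = \<Lambda> (trunc_kernel (nonneg_range N) z)"
      unfolding L1_contraction_trunc_kernel[OF \<Lambda> finite_ranges(1)]
    proof (intro sum.cong refl arg_cong2[where f = "(*)"] prod.cong)
      fix \<alpha> :: "'a \<Rightarrow> int" and k assume "\<alpha> \<in> PiE UNIV (\<lambda>_. nonneg_range N)"
      then have "\<alpha> k \<in> nonneg_range N" by (auto simp: PiE_UNIV_domain)
      then show "(z $ k) ^ nat (\<alpha> k) = poisson_coeff (z $ k) (\<alpha> k)"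
        by (auto simp: poisson_coeff_def nonneg_range_def)
    qed
  qed
  finally show ?thesis .
qed

lemma polyfun_continuous: "polyfun p \<Longrightarrow> continuous_on S p"
  by (induction rule: polyfun.induct) (auto intro!: continuous_intros)

lemma polyfun_holomorphic_slice: "polyfun p \<Longrightarrow> (\<lambda>\<zeta>. p (vupd z k \<zeta>)) holomorphic_on S"
proof (induction rule: polyfun.induct)
  case (monom c \<alpha>)
  have "(\<lambda>\<zeta>. vupd z k \<zeta> $ j ^ \<alpha> j) holomorphic_on S" for j
    by (cases "j = k") (auto simp: vupd_nth intro!: holomorphic_intros)
  then show ?case by (intro holomorphic_on_mult holomorphic_on_const holomorphic_on_prod) auto
qed (auto intro!: holomorphic_intros)

text \<open>The torus has total mass 1, so a contraction on L1 does not increase the uniform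
  distance of two kernels, and the uniformity in z is inherited.\<close>

lemma uniform_limit_contraction_kernel:
  fixes \<Lambda> :: "(real^'n::finite \<Rightarrow> complex) \<Rightarrow> complex"
  assumes \<Lambda>: "L1_contraction \<Lambda>" and \<rho>: "0 \<le> \<rho>" "\<rho> < 1"
  shows "uniform_limit {z. \<forall>k. cmod (z $ k) \<le> \<rho>} (\<lambda>N z. \<Lambda> (trunc_kernel (nonneg_range N) z))
    (\<lambda>z. \<Lambda> (\<lambda>\<theta>. cnj (szk z \<theta>))) sequentially"
proof (rule uniform_limitI)
  fix e :: real assume "e > 0"
  then have "\<forall>\<^sub>F N in sequentially. \<forall>p\<in>kernel_region \<rho>.
      dist (trunc_kernel (nonneg_range N) (fst p) (snd p :: real^'n)) (cnj (szk (fst p) (snd p))) < e / 2"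
    by (intro uniform_limitD[OF uniform_limit_kernels(1)[OF \<rho>]]) simp
  then show "\<forall>\<^sub>F N in sequentially. \<forall>z\<in>{z. \<forall>k. cmod (z $ k) \<le> \<rho>}.
      dist (\<Lambda> (trunc_kernel (nonneg_range N) z)) (\<Lambda> (\<lambda>\<theta>. cnj (szk z \<theta>))) < e"
  proof eventually_elim
    case (elim N)
    show ?case
    proof
      fix z :: "complex^'n" assume z: "z \<in> {z. \<forall>k. cmod (z $ k) \<le> \<rho>}"
      then have zp: "z \<in> polydisc" using \<rho> by (auto simp: polydisc_def intro: le_less_trans)
      have "cmod (\<Lambda> (trunc_kernel (nonneg_range N) z) - \<Lambda> (\<lambda>\<theta>. cnj (szk z \<theta>))) \<le> e / 2"
      proof (rule L1_contraction_diff_le[OF \<Lambda>])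
        show "cmod (trunc_kernel (nonneg_range N) z \<theta> - cnj (szk z \<theta>)) \<le> e / 2" for \<theta>
          using elim[rule_format, of "(z, \<theta>)"] z by (simp add: kernel_region_def dist_norm)
      qed (intro continuous_integrable_tmeas continuous_cnj_szk zp continuous_intros)+
      then show "dist (\<Lambda> (trunc_kernel (nonneg_range N) z)) (\<Lambda> (\<lambda>\<theta>. cnj (szk z \<theta>))) < e"
        using \<open>e > 0\<close> by (simp add: dist_norm)
    qed
  qed
qed

lemma holo_polydisc_contraction:
  fixes \<Lambda> :: "(real^'n::finite \<Rightarrow> complex) \<Rightarrow> complex"
  assumes \<Lambda>: "L1_contraction \<Lambda>"
  shows "holo_polydisc (\<lambda>z. \<Lambda> (\<lambda>\<theta>. cnj (szk z \<theta>)))"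
  unfolding holo_polydisc_def vupd_def[symmetric]
proof (intro conjI ballI allI)
  let ?\<Phi> = "\<lambda>z. \<Lambda> (\<lambda>\<theta>. cnj (szk z \<theta>))"
  show "continuous_on polydisc ?\<Phi>"
  proof (rule continuous_at_imp_continuous_on, rule ballI)
    fix z :: "complex^'n" assume "z \<in> polydisc"
    then obtain \<rho> where \<rho>: "0 \<le> \<rho>" "\<rho> < 1" "\<And>k. cmod (z $ k) < \<rho>" using polydisc_radius by blast
    \<comment> \<open>Continuity is first obtained on a closed polydisc; the open one inside it is a
      neighbourhood of z, which turns it into continuity at z.\<close>
    let ?U = "\<Inter>k. {z :: complex^'n. cmod (z $ k) < \<rho>}"
    have "continuous_on {z. \<forall>k. cmod (z $ k) \<le> \<rho>} ?\<Phi>"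
      by (rule uniform_limit_theorem[OF _ uniform_limit_contraction_kernel[OF \<Lambda> \<rho>(1,2)]])
         (auto intro!: always_eventually polyfun_continuous polyfun_contraction_trunc_kernel \<Lambda>)
    then have "continuous_on ?U ?\<Phi>"
      by (rule continuous_on_subset) (auto intro: less_imp_le)
    moreover have "open ?U"
      by (intro open_INT ballI open_Collect_less continuous_intros) auto
    ultimately show "isCont ?\<Phi> z" using \<rho>(3) by (simp add: continuous_on_eq_continuous_at)
  qed
  fix z :: "complex^'n" and k assume z: "z \<in> polydisc"
  show "(\<lambda>\<zeta>. ?\<Phi> (vupd z k \<zeta>)) holomorphic_on ball 0 1"
  proof (rule holomorphic_uniform_sequence)
    show "(\<lambda>\<zeta>. \<Lambda> (trunc_kernel (nonneg_range N) (vupd z k \<zeta>))) holomorphic_on ball 0 1" for N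
      using polyfun_holomorphic_slice[OF polyfun_contraction_trunc_kernel[OF \<Lambda>]] .
    fix x :: complex assume x: "x \<in> ball 0 1"
    obtain \<rho> where \<rho>: "0 \<le> \<rho>" "\<rho> < 1" "\<And>k. cmod (z $ k) < \<rho>" using polydisc_radius[OF z] by blast
    \<comment> \<open>Half the distance from x to the unit circle, so that the closed disc around x
      stays inside the open unit disc.\<close>
    define d where "d = (1 - cmod x) / 2"
    have d: "d > 0" "cmod x + d < 1" using x by (auto simp: d_def field_simps)
    have cb: "cmod u \<le> cmod x + d" if "u \<in> cball x d" for u
      using that norm_triangle_sub[of u x] by (simp add: dist_norm norm_minus_commute)
    \<comment> \<open>A single radius for both the coordinate that moves in the disc and the
      coordinates of z that stay fixed.\<close>
    define \<sigma> where "\<sigma> = max \<rho> (cmod x + d)"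
    have \<sigma>: "0 \<le> \<sigma>" "\<sigma> < 1" using \<rho> d by (auto simp: \<sigma>_def)
    have "vupd z k \<in> cball x d \<rightarrow> {z. \<forall>k. cmod (z $ k) \<le> \<sigma>}"
      using cb \<rho>(3) by (auto simp: vupd_nth \<sigma>_def le_max_iff_disj less_imp_le)
    from uniform_limit_compose'[OF uniform_limit_contraction_kernel[OF \<Lambda> \<sigma>] this]
    have "uniform_limit (cball x d) (\<lambda>N \<zeta>. \<Lambda> (trunc_kernel (nonneg_range N) (vupd z k \<zeta>)))
      (\<lambda>\<zeta>. ?\<Phi> (vupd z k \<zeta>)) sequentially" .
    moreover have "cball x d \<subseteq> ball 0 1" using cb d by force
    ultimately show "\<exists>d>0. cball x d \<subseteq> ball 0 1 \<and>
        uniform_limit (cball x d) (\<lambda>N \<zeta>. \<Lambda> (trunc_kernel (nonneg_range N) (vupd z k \<zeta>)))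
          (\<lambda>\<zeta>. ?\<Phi> (vupd z k \<zeta>)) sequentially"
      using d(1) by blast
  qed simp
qed

theorem schur_class_contraction:
  fixes \<Lambda> :: "(real^'n::finite \<Rightarrow> complex) \<Rightarrow> complex"
  assumes \<Lambda>: "L1_contraction \<Lambda>" and Mn: "\<forall>h\<in>Mn. \<Lambda> h = 0" and H2_0: "\<forall>h\<in>H2_0. \<Lambda> h = 0"
  shows "(\<lambda>z. \<Lambda> (\<lambda>\<theta>. cnj (szk z \<theta>))) \<in> schur_class"
proof -
  have "cmod (\<Lambda> (\<lambda>\<theta>. cnj (szk z \<theta>))) \<le> 1" if z: "z \<in> polydisc" for z :: "complex^'n"
  proof -
    have lim: "(\<lambda>N. \<Lambda> (f N)) \<longlonglongrightarrow> \<Lambda> g"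
      if fg: "uniform_limit UNIV f g sequentially" "\<And>N. continuous_on UNIV (f N)" "continuous_on UNIV g" for f g
    proof (rule LIMSEQ_I)
      fix e :: real assume e: "e > 0"
      then have "0 < e / 2" by simp
      then obtain N0 where N0: "\<And>N \<theta>. N \<ge> N0 \<Longrightarrow> dist (f N \<theta>) (g \<theta>) < e / 2"
        using fg(1)[unfolded uniform_limit_sequentially_iff, rule_format, of "e / 2"] by auto
      have *: "cmod (\<Lambda> (f N) - \<Lambda> g) \<le> e / 2" if "N \<ge> N0" for N
        using N0[OF that]
        by (intro L1_contraction_diff_le[OF \<Lambda>] continuous_integrable_tmeas fg) (simp add: dist_norm less_imp_le)
      show "\<exists>N0. \<forall>N\<ge>N0. norm (\<Lambda> (f N) - \<Lambda> g) < e"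
      proof (intro exI[of _ N0] allI impI)
        fix N assume "N \<ge> N0"
        from *[OF this] show "norm (\<Lambda> (f N) - \<Lambda> g) < e" using e by linarith
      qed
    qed
    have "(\<lambda>N. \<Lambda> (trunc_kernel (nonneg_range N) z)) \<longlonglongrightarrow> \<Lambda> (\<lambda>\<theta>. cnj (szk z \<theta>))"
      by (intro lim uniform_limit_kernels_at z continuous_intros continuous_cnj_szk)
    moreover have "(\<lambda>N. \<Lambda> (trunc_kernel (sym_range N) z)) \<longlonglongrightarrow> \<Lambda> (poisson_kernel z)"
      by (intro lim uniform_limit_kernels_at z continuous_intros continuous_poisson_kernel)
    \<comment> \<open>The two sequences coincide term by term, so the limits do. From here on the
      value is bounded through the Poisson kernel, of L1 norm 1.\<close>
    ultimately have "\<Lambda> (\<lambda>\<theta>. cnj (szk z \<theta>)) = \<Lambda> (poisson_kernel z)"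
      unfolding L1_contraction_sym_range[OF assms] by (rule LIMSEQ_unique)
    then show ?thesis
      using L1_contraction_norm[OF \<Lambda> continuous_integrable_tmeas[OF continuous_poisson_kernel[OF z]]]
      by (simp add: integral_norm_poisson_kernel[OF z])
  qed
  with holo_polydisc_contraction[OF \<Lambda>] show ?thesis by (simp add: schur_class_def)
qed

section \<open>The interpolation criterion\<close>

text \<open>All four claims hold for the approximating polynomials and pass to the uniform limit on
  the torus. The kernel reproduces the dilated function, hence the value at
  \<open>r *\<^sub>R z\<close>.\<close>

lemma integral_dilation:
  assumes \<phi>: "\<phi> \<in> schur_class" and r: "0 \<le> r" "r < 1"
  shows "continuous_on UNIV (\<lambda>\<theta>. \<phi> (r *\<^sub>R tpt \<theta>))"
    and "z \<in> polydisc \<Longrightarrow> (\<integral>\<theta>. \<phi> (r *\<^sub>R tpt \<theta>) * cnj (szk z \<theta>) \<partial>tmeas) = \<phi> (r *\<^sub>R z)"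
    and "b \<in> Mn \<Longrightarrow> (\<integral>\<theta>. \<phi> (r *\<^sub>R tpt \<theta>) * b \<theta> \<partial>tmeas) = 0"
    and "c \<in> H2_0 \<Longrightarrow> (\<integral>\<theta>. \<phi> (r *\<^sub>R tpt \<theta>) * c \<theta> \<partial>tmeas) = 0"
proof -
  have "\<exists>p. polyfun p \<and> (\<forall>z\<in>cpolydisc. cmod (\<phi> (r *\<^sub>R z) - p z) < 1 / real (Suc N))" for N
    using \<phi> r by (intro polyfun_approx[where C = 1]) (auto simp: schur_class_def)
  then obtain P where P: "\<And>N. polyfun (P N)"
    "\<And>N z. z \<in> cpolydisc \<Longrightarrow> cmod (\<phi> (r *\<^sub>R z) - P N z) < 1 / real (Suc N)" by metis
  have unif: "uniform_limit cpolydisc P (\<lambda>z. \<phi> (r *\<^sub>R z)) sequentially"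
  proof (rule uniform_limitI)
    fix e :: real assume "e > 0"
    then have "\<forall>\<^sub>F N in sequentially. 1 / real (Suc N) < e"
      using LIMSEQ_inverse_real_of_nat by (intro order_tendstoD(2)) (auto simp: inverse_eq_divide)
    then show "\<forall>\<^sub>F N in sequentially. \<forall>z\<in>cpolydisc. dist (P N z) (\<phi> (r *\<^sub>R z)) < e"
    proof eventually_elim
      case (elim N)
      show ?case
        using P(2)[of _ N] elim by (auto simp: dist_norm norm_minus_commute intro: less_trans)
    qed
  qed
  have "range tpt \<subseteq> cpolydisc" by (auto simp: cpolydisc_def)
  then have lim: "uniform_limit UNIV (\<lambda>N \<theta>. P N (tpt \<theta>)) (\<lambda>\<theta>. \<phi> (r *\<^sub>R tpt \<theta>)) sequentially"
    by (intro uniform_limit_compose'[OF unif]) auto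
  have cont: "continuous_on UNIV (\<lambda>\<theta>. P N (tpt \<theta>))" for N
    by (rule integral_polyfun(4)[OF P(1)])
  show "continuous_on UNIV (\<lambda>\<theta>. \<phi> (r *\<^sub>R tpt \<theta>))"
    by (rule uniform_limit_theorem[OF _ lim]) (use cont in auto)
  have int: "(\<lambda>N. \<integral>\<theta>. P N (tpt \<theta>) * u \<theta> \<partial>tmeas) \<longlonglongrightarrow> (\<integral>\<theta>. \<phi> (r *\<^sub>R tpt \<theta>) * u \<theta> \<partial>tmeas)"
    if "integrable tmeas u" for u
    by (rule uniform_limit_integral_tmeas[OF lim cont that])
  show "(\<integral>\<theta>. \<phi> (r *\<^sub>R tpt \<theta>) * cnj (szk z \<theta>) \<partial>tmeas) = \<phi> (r *\<^sub>R z)" if z: "z \<in> polydisc"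
  proof (rule LIMSEQ_unique)
    show "(\<lambda>N. P N z) \<longlonglongrightarrow> (\<integral>\<theta>. \<phi> (r *\<^sub>R tpt \<theta>) * cnj (szk z \<theta>) \<partial>tmeas)"
      using int[OF continuous_integrable_tmeas[OF continuous_cnj_szk[OF z]]]
      by (simp only: integral_polyfun(1)[OF P(1) z])
    show "(\<lambda>N. P N z) \<longlonglongrightarrow> \<phi> (r *\<^sub>R z)"
      by (rule tendsto_uniform_limitI[OF unif])
         (use z in \<open>auto simp: polydisc_def cpolydisc_def less_imp_le\<close>)
  qed
  show "(\<integral>\<theta>. \<phi> (r *\<^sub>R tpt \<theta>) * b \<theta> \<partial>tmeas) = 0" if b: "b \<in> Mn"
    using int[OF L2_integrable[OF subsetD[OF Mn_subset_L2 b]]]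
    by (simp add: integral_polyfun(2)[OF P(1) b] LIMSEQ_const_iff)
  show "(\<integral>\<theta>. \<phi> (r *\<^sub>R tpt \<theta>) * c \<theta> \<partial>tmeas) = 0" if c: "c \<in> H2_0"
    using int[OF L2_integrable[OF subsetD[OF H2_subset_L2 subsetD[OF H2_0_subset_H2 c]]]]
    by (simp add: integral_polyfun(3)[OF P(1) c] LIMSEQ_const_iff)
qed

lemma linner_self: "linner f f = of_real (l2normsq f)"
proof -
  have "linner f f = (\<integral>\<theta>. of_real ((cmod (f \<theta>))\<^sup>2) \<partial>tmeas)"
    unfolding linner_def by (simp only: complex_norm_square)
  then show ?thesis by (simp only: l2normsq_def integral_complex_of_real)
qed

section \<open>Linear structure of the span of kernels and of the sums of spaces\<close>

lemma QZ_L2: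
  assumes "\<forall>i<m. z i \<in> polydisc" "f \<in> QZ m z"
  shows "f \<in> L2"
proof -
  obtain d where f: "f = (\<lambda>\<theta>. \<Sum>i<m. d i * szk (z i) \<theta>)" using assms(2) by (auto simp: QZ_def)
  show ?thesis unfolding f
    by (rule L2_continuous) (use assms(1) in \<open>auto intro!: continuous_intros continuous_szk\<close>)
qed

lemma QZ_add:
  assumes "f \<in> QZ m z" "g \<in> QZ m z" shows "(\<lambda>\<theta>. f \<theta> + g \<theta>) \<in> QZ m z"
proof -
  obtain c d where "f = (\<lambda>\<theta>. \<Sum>i<m. c i * szk (z i) \<theta>)" "g = (\<lambda>\<theta>. \<Sum>i<m. d i * szk (z i) \<theta>)"
    using assms by (auto simp: QZ_def)
  then have "(\<lambda>\<theta>. f \<theta> + g \<theta>) = (\<lambda>\<theta>. \<Sum>i<m. (c i + d i) * szk (z i) \<theta>)"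
    by (simp add: distrib_right sum.distrib)
  then show ?thesis unfolding QZ_def by (intro CollectI exI conjI TrueI)
qed

lemma QZ_cmult:
  assumes "f \<in> QZ m z" shows "(\<lambda>\<theta>. a * f \<theta>) \<in> QZ m z"
proof -
  obtain c where "f = (\<lambda>\<theta>. \<Sum>i<m. c i * szk (z i) \<theta>)"
    using assms by (auto simp: QZ_def)
  then have "(\<lambda>\<theta>. a * f \<theta>) = (\<lambda>\<theta>. \<Sum>i<m. (a * c i) * szk (z i) \<theta>)"
    by (simp add: sum_distrib_left mult.assoc)
  then show ?thesis unfolding QZ_def by (intro CollectI exI conjI TrueI)
qed

lemma szk_QZ:
  assumes "i < m" shows "szk (z i) \<in> QZ m z"
proof -
  have "szk (z i) = (\<lambda>\<theta>. \<Sum>j<m. (if j = i then 1 else 0) * szk (z j) \<theta>)"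
    using assms by (simp add: if_distrib[where f = "\<lambda>x. x * _"] cong: if_cong)
  then show ?thesis unfolding QZ_def by (intro CollectI exI conjI TrueI)
qed

lemma conjset_add:
  assumes "\<And>f g. f \<in> S \<Longrightarrow> g \<in> S \<Longrightarrow> (\<lambda>\<theta>. f \<theta> + g \<theta>) \<in> S" "a \<in> conjset S" "b \<in> conjset S"
  shows "(\<lambda>\<theta>. a \<theta> + b \<theta>) \<in> conjset S"
proof -
  obtain f g where "f \<in> S" "g \<in> S" "a = (\<lambda>\<theta>. cnj (f \<theta>))" "b = (\<lambda>\<theta>. cnj (g \<theta>))"
    using assms(2,3) by (auto simp: conjset_def)
  then show ?thesis unfolding conjset_def
    by (intro image_eqI[OF _ assms(1)[of f g]]) auto
qed

lemma conjset_cmult: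
  assumes "\<And>c f. f \<in> S \<Longrightarrow> (\<lambda>\<theta>. c * f \<theta>) \<in> S" "a \<in> conjset S"
  shows "(\<lambda>\<theta>. c * a \<theta>) \<in> conjset S"
proof -
  obtain f where "f \<in> S" "a = (\<lambda>\<theta>. cnj (f \<theta>))"
    using assms(2) by (auto simp: conjset_def)
  then show ?thesis unfolding conjset_def
    by (intro image_eqI[OF _ assms(1)[of f "cnj c"]]) auto
qed

lemma setsum_add:
  assumes "\<And>f g. f \<in> A \<Longrightarrow> g \<in> A \<Longrightarrow> (\<lambda>\<theta>. f \<theta> + g \<theta>) \<in> A" "\<And>f g. f \<in> B \<Longrightarrow> g \<in> B \<Longrightarrow> (\<lambda>\<theta>. f \<theta> + g \<theta>) \<in> B"
    and "h \<in> setsum A B" "k \<in> setsum A B"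
  shows "(\<lambda>\<theta>. h \<theta> + k \<theta>) \<in> setsum A B"
proof -
  obtain a b where ab: "a \<in> A" "b \<in> B" "h = (\<lambda>\<theta>. a \<theta> + b \<theta>)" using assms(3) by (auto simp: setsum_def)
  obtain c d where cd: "c \<in> A" "d \<in> B" "k = (\<lambda>\<theta>. c \<theta> + d \<theta>)" using assms(4) by (auto simp: setsum_def)
  have "(\<lambda>\<theta>. h \<theta> + k \<theta>) = (\<lambda>\<theta>. (a \<theta> + c \<theta>) + (b \<theta> + d \<theta>))" using ab cd by (simp add: algebra_simps)
  then show ?thesis
    using assms(1)[OF ab(1) cd(1)] assms(2)[OF ab(2) cd(2)] unfolding setsum_def
    by (intro CollectI exI[of _ "\<lambda>\<theta>. a \<theta> + c \<theta>"] exI[of _ "\<lambda>\<theta>. b \<theta> + d \<theta>"]) auto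
qed

lemma setsum_cmult:
  assumes "\<And>c f. f \<in> A \<Longrightarrow> (\<lambda>\<theta>. c * f \<theta>) \<in> A" "\<And>c f. f \<in> B \<Longrightarrow> (\<lambda>\<theta>. c * f \<theta>) \<in> B" "h \<in> setsum A B"
  shows "(\<lambda>\<theta>. c * h \<theta>) \<in> setsum A B"
proof -
  obtain a b where ab: "a \<in> A" "b \<in> B" "h = (\<lambda>\<theta>. a \<theta> + b \<theta>)" using assms(3) by (auto simp: setsum_def)
  then show ?thesis
    using assms(1)[OF ab(1)] assms(2)[OF ab(2)] unfolding setsum_def
    by (intro CollectI exI[of _ "\<lambda>\<theta>. c * a \<theta>"] exI[of _ "\<lambda>\<theta>. c * b \<theta>"]) (auto simp: distrib_left)
qed

lemma setsum_left: "a \<in> A \<Longrightarrow> (\<lambda>_. 0) \<in> B \<Longrightarrow> a \<in> setsum A B"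
  unfolding setsum_def by (intro CollectI exI[of _ a] exI[of _ "\<lambda>_. 0"]) auto

lemma setsum_right: "(\<lambda>_. 0) \<in> A \<Longrightarrow> b \<in> B \<Longrightarrow> b \<in> setsum A B"
  unfolding setsum_def by (intro CollectI exI[of _ "\<lambda>_. 0"] exI[of _ b]) auto

text \<open>\<open>X_adj\<close> encodes the action of the adjoint on kernels: the scalar cnj
  (\<open>w j\<close>) in the second slot of the inner product comes out as \<open>w j\<close>. The
  projection of 1 is the variable \<open>q\<close>, fixed by membership and orthogonality, and
  \<open>psi_nz\<close> keeps the quotient from being a division by zero.\<close>

theorem theorem7p1:
  fixes z :: "nat \<Rightarrow> complex^'n::finite"
    and w :: "nat \<Rightarrow> complex"
    and m :: nat
    and q :: "real^'n \<Rightarrow> complex"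
    and X :: "(real^'n \<Rightarrow> complex) \<Rightarrow> (real^'n \<Rightarrow> complex)"
  assumes z_in: "\<forall>i<m. z i \<in> polydisc"
    and z_dist: "inj_on z {..<m}"
    and w_in: "\<forall>i<m. cmod (w i) < 1"
    and q_proj: "q \<in> QZ m z \<and> (\<forall>g\<in>QZ m z. linner (\<lambda>\<theta>. 1 - q \<theta>) g = 0)"
    and X_maps: "\<forall>f\<in>QZ m z. X f \<in> QZ m z"
    and X_adj: "\<forall>f\<in>QZ m z. \<forall>j<m. linner (X f) (szk (z j)) = w j * linner f (szk (z j))"
    and psi_nz: "l2normsq (X q) \<noteq> 0"
  shows "((\<exists>\<phi>\<in>schur_class. \<forall>i<m. \<phi> (z i) = w i) \<longleftrightarrow>
          dist_L1 (\<lambda>\<theta>. cnj (X q \<theta>) / of_real (l2normsq (X q)))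
            (setsum (setsum (ominus1 (conjset (QZ m z)) (\<lambda>\<theta>. cnj (X q \<theta>))) Mn) H2_0) \<ge> 1)
       \<and> ((\<exists>\<phi>\<in>schur_class. \<forall>i<m. \<phi> (z i) = w i) \<longrightarrow> (\<forall>i<m. hval (X q) (z i) = w i))"
proof -
  define \<psi> where "\<psi> = X q"
  define s where "s = complex_of_real (l2normsq \<psi>)"
  define g where "g = (\<lambda>\<theta>. cnj (\<psi> \<theta>) / s)"
  define O1 where "O1 = ominus1 (conjset (QZ m z)) (\<lambda>\<theta>. cnj (\<psi> \<theta>))"
  define M where "M = setsum (setsum O1 Mn) H2_0"
  have s: "s \<noteq> 0" using psi_nz by (simp add: s_def \<psi>_def)
  have \<psi>Q: "\<psi> \<in> QZ m z" using q_proj X_maps by (simp add: \<psi>_def)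
  have \<psi>L: "\<psi> \<in> L2" by (rule QZ_L2[OF z_in \<psi>Q])
  have szL: "szk (z i) \<in> L2" if "i < m" for i using z_in that by (simp add: szk_L2)
  \<comment> \<open>As 1 - q is orthogonal to the kernels, q has the value 1 at every node, and X
    multiplies this by \<open>w i\<close>. This is also the last claim of the theorem.\<close>
  have \<psi>w: "linner \<psi> (szk (z i)) = w i" if i: "i < m" for i
  proof -
    have one: "(\<lambda>_::real^'n. 1) \<in> L2" by (intro L2_continuous continuous_intros)
    have qL: "q \<in> L2" using q_proj QZ_L2[OF z_in] by blast
    have "linner (\<lambda>\<theta>. 1 + - 1 * q \<theta>) (szk (z i)) = 0"
      using q_proj szk_QZ[OF i, of z] by simp
    then have "linner q (szk (z i)) = linner (\<lambda>_. 1) (szk (z i))"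
      using linner_add_left[OF one L2_cmult[OF qL, of "- 1"] szL[OF i]]
        linner_cmult_left[of "- 1" q "szk (z i)"] by simp
    also have "\<dots> = 1"
      using integral_polyfun(1)[OF polyfun_const[of 1], of "z i"] z_in i by (simp add: linner_def)
    finally show ?thesis using X_adj q_proj i by (simp add: \<psi>_def)
  qed
  have \<psi>f: "linner \<psi> (\<lambda>\<theta>. \<Sum>i<m. d i * szk (z i) \<theta>) = (\<Sum>i<m. cnj (d i) * w i)" for d
  proof -
    have "linner \<psi> (\<lambda>\<theta>. \<Sum>i<m. d i * szk (z i) \<theta>)
        = (\<integral>\<theta>. (\<Sum>i<m. cnj (d i) * (\<psi> \<theta> * cnj (szk (z i) \<theta>))) \<partial>tmeas)"
      by (simp add: linner_def sum_distrib_left mult_ac)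
    also have "\<dots> = (\<Sum>i<m. cnj (d i) * linner \<psi> (szk (z i)))"
      unfolding linner_def
      by (subst Bochner_Integration.integral_sum)
         (auto intro!: integrable_mult_right linner_integrable \<psi>L szL)
    finally show ?thesis using \<psi>w by simp
  qed
  have O1L: "h \<in> L2" if "h \<in> O1" for h
    using that QZ_L2[OF z_in] by (auto simp: O1_def ominus1_def conjset_def intro: L2_cnj)
  \<comment> \<open>Conjugating both arguments swaps their roles: the inner product of cnj f with
    cnj \<psi> is that of \<psi> with f.\<close>
  have O1_iff: "h \<in> O1 \<longleftrightarrow> (\<exists>f\<in>QZ m z. h = (\<lambda>\<theta>. cnj (f \<theta>)) \<and> linner \<psi> f = 0)" for h
    by (auto simp: O1_def ominus1_def conjset_def linner_def mult.commute)
  have dir1: "dist_L1 g M \<ge> 1" if \<phi>: "\<phi> \<in> schur_class" and \<phi>w: "\<And>i. i < m \<Longrightarrow> \<phi> (z i) = w i" for \<phi>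
    unfolding dist_L1_def
  proof (rule INF_greatest)
    fix h assume "h \<in> M"
    then obtain a b c where h: "h = (\<lambda>\<theta>. (a \<theta> + b \<theta>) + c \<theta>)" and abc: "a \<in> O1" "b \<in> Mn" "c \<in> H2_0"
      by (auto simp: M_def setsum_def)
    obtain f where f: "f \<in> QZ m z" "a = (\<lambda>\<theta>. cnj (f \<theta>))" "linner \<psi> f = 0" using abc(1) O1_iff by blast
    obtain e where e: "f = (\<lambda>\<theta>. \<Sum>i<m. e i * szk (z i) \<theta>)" using f(1) by (auto simp: QZ_def)
    obtain d where d: "\<psi> = (\<lambda>\<theta>. \<Sum>i<m. d i * szk (z i) \<theta>)" using \<psi>Q by (auto simp: QZ_def)
    \<comment> \<open>The coefficients of g - a in the conjugate kernels. Pairing with the data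
      gives 1 from the first term, by the normalization of g, and 0 from the second, by
      orthogonality.\<close>
    define v where "v i = cnj (d i) / s - cnj (e i)" for i
    have vw: "(\<Sum>i<m. v i * w i) = 1"
    proof -
      have "(\<Sum>i<m. cnj (d i) * w i) = s"
        using \<psi>f[of d] linner_self[of \<psi>] by (simp add: d[symmetric] s_def)
      moreover have "(\<Sum>i<m. cnj (e i) * w i) = 0"
        using \<psi>f[of e] f(3) by (simp add: e[symmetric])
      ultimately show ?thesis
        using s by (simp add: v_def left_diff_distrib sum_subtractf flip: sum_divide_distrib)
    qed
    define U where "U = (\<lambda>\<theta>. g \<theta> - h \<theta>)"
    have U: "U = (\<lambda>\<theta>. (\<Sum>i<m. v i * cnj (szk (z i) \<theta>)) - b \<theta> - c \<theta>)"
    proof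
      fix \<theta>
      have "cnj (\<psi> \<theta>) = (\<Sum>i<m. cnj (d i) * cnj (szk (z i) \<theta>))" by (subst d) simp
      moreover have "a \<theta> = (\<Sum>i<m. cnj (e i) * cnj (szk (z i) \<theta>))" by (simp add: f(2) e)
      ultimately show "U \<theta> = (\<Sum>i<m. v i * cnj (szk (z i) \<theta>)) - b \<theta> - c \<theta>"
        by (simp add: U_def g_def h v_def left_diff_distrib sum_subtractf sum_divide_distrib)
    qed
    have intb: "integrable tmeas b" using abc Mn_subset_L2 by (auto intro: L2_integrable)
    have intc: "integrable tmeas c" using abc H2_0_subset_H2 H2_subset_L2 by (auto intro: L2_integrable)
    have intS: "integrable tmeas (\<lambda>\<theta>. cnj (szk (z i) \<theta>))" if "i < m" for i
      using szL[OF that] by (intro L2_integrable L2_cnj)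
    have intU: "integrable tmeas U"
      unfolding U using intb intc intS
      by (intro Bochner_Integration.integrable_diff Bochner_Integration.integrable_sum integrable_mult_right) auto
    define I where "I = (\<integral>\<theta>. cmod (U \<theta>) \<partial>tmeas)"
    have bound: "cmod (\<Sum>i<m. v i * \<phi> (r *\<^sub>R z i)) \<le> I" if r: "0 \<le> r" "r < 1" for r
    proof -
      let ?F = "\<lambda>\<theta>. \<phi> (r *\<^sub>R tpt \<theta>)"
      note D = integral_dilation[OF \<phi> r]
      have iS: "integrable tmeas (\<lambda>\<theta>. v i * (?F \<theta> * cnj (szk (z i) \<theta>)))" if "i < m" for i
        by (intro integrable_mult_right integrable_continuous_mult[OF D(1)] intS that)
      have "(\<integral>\<theta>. ?F \<theta> * U \<theta> \<partial>tmeas)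
          = (\<integral>\<theta>. (\<Sum>i<m. v i * (?F \<theta> * cnj (szk (z i) \<theta>))) - ?F \<theta> * b \<theta> - ?F \<theta> * c \<theta> \<partial>tmeas)"
        by (simp add: U right_diff_distrib sum_distrib_left mult_ac)
      also have "\<dots> = (\<integral>\<theta>. (\<Sum>i<m. v i * (?F \<theta> * cnj (szk (z i) \<theta>))) \<partial>tmeas)
          - (\<integral>\<theta>. ?F \<theta> * b \<theta> \<partial>tmeas) - (\<integral>\<theta>. ?F \<theta> * c \<theta> \<partial>tmeas)"
        using iS integrable_continuous_mult[OF D(1) intb] integrable_continuous_mult[OF D(1) intc]
        by (subst Bochner_Integration.integral_diff; (subst Bochner_Integration.integral_diff)?)
           (auto intro!: Bochner_Integration.integrable_diff Bochner_Integration.integrable_sum)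
      also have "\<dots> = (\<integral>\<theta>. (\<Sum>i<m. v i * (?F \<theta> * cnj (szk (z i) \<theta>))) \<partial>tmeas)"
        using D(3)[OF abc(2)] D(4)[OF abc(3)] by simp
      also have "\<dots> = (\<Sum>i<m. v i * \<phi> (r *\<^sub>R z i))"
        using iS D(2) z_in by (subst Bochner_Integration.integral_sum) auto
      finally have "(\<Sum>i<m. v i * \<phi> (r *\<^sub>R z i)) = (\<integral>\<theta>. ?F \<theta> * U \<theta> \<partial>tmeas)" by simp
      also have "cmod \<dots> \<le> 1 * I"
        unfolding I_def
      proof (rule norm_integral_mult_le[OF intU])
        fix \<theta> :: "real^'n"
        have "r *\<^sub>R tpt \<theta> \<in> polydisc" by (rule scaleR_cpolydisc[OF _ r]) (simp add: cpolydisc_def)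
        then show "cmod (?F \<theta>) \<le> 1" using \<phi> by (simp add: schur_class_def)
      qed
      finally show ?thesis by simp
    qed
    \<comment> \<open>Dilation radii in [0, 1) that tend to 1; continuity of \<phi> at the interior
      points \<open>z i\<close> then suffices for the limit.\<close>
    define \<rho> where "\<rho> N = 1 - inverse (real (Suc N))" for N
    have \<rho>: "0 \<le> \<rho> N" "\<rho> N < 1" for N by (auto simp: \<rho>_def field_simps)
    have \<rho>lim: "\<rho> \<longlonglongrightarrow> 1"
      unfolding \<rho>_def using tendsto_diff[OF tendsto_const LIMSEQ_inverse_real_of_nat, of 1] by simp
    have "(\<lambda>N. \<phi> (\<rho> N *\<^sub>R z i)) \<longlonglongrightarrow> \<phi> (z i)" if i: "i < m" for i
    proof (rule continuous_on_tendsto_compose[where s = polydisc and f = \<phi>])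
      show "continuous_on polydisc \<phi>" using \<phi> by (simp add: schur_class_def holo_polydisc_def)
      show "(\<lambda>N. \<rho> N *\<^sub>R z i) \<longlonglongrightarrow> z i" using tendsto_scaleR[OF \<rho>lim tendsto_const[of "z i"]] by simp
      show "z i \<in> polydisc" using z_in i by blast
      then have "z i \<in> cpolydisc" by (simp add: polydisc_def cpolydisc_def less_imp_le)
      then show "\<forall>\<^sub>F N in sequentially. \<rho> N *\<^sub>R z i \<in> polydisc"
        using scaleR_cpolydisc[OF _ \<rho>] by (intro always_eventually) blast
    qed
    then have "(\<lambda>N. \<Sum>i<m. v i * \<phi> (\<rho> N *\<^sub>R z i)) \<longlonglongrightarrow> (\<Sum>i<m. v i * w i)"
      using \<phi>w by (intro tendsto_sum tendsto_mult tendsto_const) auto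
    then have "(\<lambda>N. cmod (\<Sum>i<m. v i * \<phi> (\<rho> N *\<^sub>R z i))) \<longlonglongrightarrow> 1"
      using vw tendsto_norm by fastforce
    then have "1 \<le> I"
      by (rule LIMSEQ_le_const2) (use bound[OF \<rho>] in blast)
    moreover have "l1norm U = ennreal I"
      unfolding l1norm_def I_def by (rule nn_integral_eq_integral) (use intU in auto)
    ultimately show "1 \<le> l1norm (\<lambda>\<theta>. g \<theta> - h \<theta>)" by (simp add: U_def[symmetric])
  qed
  have dir2: "\<exists>\<phi>\<in>schur_class. \<forall>i<m. \<phi> (z i) = w i" if dist: "dist_L1 g M \<ge> 1"
  proof -
    have cL: "(\<lambda>\<theta>. cnj (\<psi> \<theta>)) \<in> L2" by (rule L2_cnj[OF \<psi>L])
    have gint: "integrable tmeas g"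
      unfolding g_def using L2_integrable[OF cL] by simp
    have O1_add: "(\<lambda>\<theta>. h \<theta> + k \<theta>) \<in> O1" if "h \<in> O1" "k \<in> O1" for h k
    proof -
      have "(\<lambda>\<theta>. h \<theta> + k \<theta>) \<in> conjset (QZ m z)"
        by (rule conjset_add[OF QZ_add]) (use that in \<open>simp_all add: O1_def ominus1_def\<close>)
      then show ?thesis
        using that linner_add_left[OF O1L[OF that(1)] O1L[OF that(2)] cL] by (simp add: O1_def ominus1_def)
    qed
    have O1_cmult: "(\<lambda>\<theta>. c * h \<theta>) \<in> O1" if "h \<in> O1" for h c
    proof -
      have "(\<lambda>\<theta>. c * h \<theta>) \<in> conjset (QZ m z)"
        by (rule conjset_cmult[OF QZ_cmult]) (use that in \<open>simp_all add: O1_def ominus1_def\<close>)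
      then show ?thesis using that by (simp add: O1_def ominus1_def linner_cmult_left)
    qed
    have zero: "(\<lambda>_. 0) \<in> O1" "(\<lambda>_. 0) \<in> (Mn :: (real^'n \<Rightarrow> complex) set)"
      "(\<lambda>_. 0) \<in> (H2_0 :: (real^'n \<Rightarrow> complex) set)"
    proof -
      have "(\<lambda>_. 0) \<in> QZ m z" using QZ_cmult[OF \<psi>Q, of 0] by simp
      then show "(\<lambda>_. 0) \<in> O1" unfolding O1_iff by (intro bexI[of _ "\<lambda>_. 0"]) (auto simp: linner_def)
      show "(\<lambda>_. 0) \<in> (Mn :: (real^'n \<Rightarrow> complex) set)"
        by (auto simp: Mn_def linner_def intro!: L2_continuous)
      show "(\<lambda>_. 0) \<in> (H2_0 :: (real^'n \<Rightarrow> complex) set)"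
        by (auto simp: H2_0_def H2_def fourier_def hval_zero intro!: L2_continuous)
    qed
    have M_O1: "h \<in> M" if "h \<in> O1" for h
      unfolding M_def by (intro setsum_left that zero)
    have M_Mn: "h \<in> M" if "h \<in> Mn" for h
      unfolding M_def by (intro setsum_left setsum_right that zero)
    have M_H2_0: "h \<in> M" if "h \<in> H2_0" for h
      unfolding M_def by (intro setsum_right[OF _ that] setsum_left zero)
    have "\<exists>\<Lambda>. L1_contraction \<Lambda> \<and> \<Lambda> g = 1 \<and> (\<forall>h\<in>M. \<Lambda> h = 0)"
    proof (rule L1_separation)
      show "M \<noteq> {}" using M_O1[OF zero(1)] by blast
      show "integrable tmeas h" if hM: "h \<in> M" for h
      proof -
        obtain a b c where "h = (\<lambda>\<theta>. (a \<theta> + b \<theta>) + c \<theta>)" "a \<in> O1" "b \<in> Mn" "c \<in> H2_0"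
          using hM by (auto simp: M_def setsum_def)
        then show ?thesis
          using O1L Mn_subset_L2 H2_0_subset_H2 H2_subset_L2 by (auto intro!: L2_integrable L2_add)
      qed
      show "(\<lambda>\<theta>. h \<theta> + k \<theta>) \<in> M" if "h \<in> M" "k \<in> M" for h k
        using that unfolding M_def by (intro setsum_add O1_add Mn_add H2_0_add)
      show "(\<lambda>\<theta>. c * h \<theta>) \<in> M" if "h \<in> M" for h c
        using that unfolding M_def by (intro setsum_cmult O1_cmult Mn_cmult H2_0_cmult)
    qed (rule gint, rule dist)
    then obtain \<Lambda> where \<Lambda>: "L1_contraction \<Lambda>" "\<Lambda> g = 1" "\<forall>h\<in>M. \<Lambda> h = 0" by blast
    have \<Lambda>\<psi>: "\<Lambda> (\<lambda>\<theta>. cnj (\<psi> \<theta>)) = s"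
      using L1_contraction_cmult[OF \<Lambda>(1) gint, of s] \<Lambda>(2) s by (simp add: g_def)
    have "\<Lambda> (\<lambda>\<theta>. cnj (szk (z i) \<theta>)) = w i" if i: "i < m" for i
    proof -
      \<comment> \<open>The component of the kernel orthogonal to \<psi>: its coefficient is - cnj
        (w i) / s, with s the squared norm of \<psi>. Its conjugate lies in the subspace, where the
        functional vanishes.\<close>
      define f where "f = (\<lambda>\<theta>. szk (z i) \<theta> + (- cnj (w i / s)) * \<psi> \<theta>)"
      define a where "a = (\<lambda>\<theta>. cnj (f \<theta>))"
      have fQ: "f \<in> QZ m z" unfolding f_def by (intro QZ_add QZ_cmult szk_QZ i \<psi>Q)
      have "linner f \<psi> = linner (szk (z i)) \<psi> + (- cnj (w i / s)) * linner \<psi> \<psi>"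
        unfolding f_def linner_add_left[OF szL[OF i] L2_cmult[OF \<psi>L] \<psi>L] linner_cmult_left ..
      also have "\<dots> = cnj (w i) - cnj (w i / s) * s"
        using \<psi>w[OF i] cnj_linner[of \<psi> "szk (z i)"] by (simp only: linner_self s_def) simp
      also have "\<dots> = 0" using s by (simp add: s_def)
      finally have "linner \<psi> f = 0" using cnj_linner[of f \<psi>] by simp
      then have "a \<in> O1" unfolding O1_iff a_def using fQ by blast
      then have "\<Lambda> a = 0" using M_O1 \<Lambda>(3) by blast
      moreover have "(\<lambda>\<theta>. cnj (szk (z i) \<theta>)) = (\<lambda>\<theta>. a \<theta> + (w i / s) * cnj (\<psi> \<theta>))"
        by (simp add: a_def f_def)
      moreover have "integrable tmeas a" unfolding a_def by (intro L2_integrable L2_cnj QZ_L2[OF z_in fQ])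
      ultimately show ?thesis
        using L1_contraction_add[OF \<Lambda>(1), of a "\<lambda>\<theta>. (w i / s) * cnj (\<psi> \<theta>)"]
          L1_contraction_cmult[OF \<Lambda>(1) L2_integrable[OF cL], of "w i / s"] \<Lambda>\<psi> s L2_integrable[OF L2_cmult[OF cL]]
        by simp
    qed
    moreover have "(\<lambda>x. \<Lambda> (\<lambda>\<theta>. cnj (szk x \<theta>))) \<in> schur_class"
      using \<Lambda>(3) M_Mn M_H2_0 by (intro schur_class_contraction[OF \<Lambda>(1)]) blast+
    ultimately show ?thesis by (intro bexI[of _ "\<lambda>x. \<Lambda> (\<lambda>\<theta>. cnj (szk x \<theta>))"]) auto
  qed
  have "(\<exists>\<phi>\<in>schur_class. \<forall>i<m. \<phi> (z i) = w i) \<longleftrightarrow> dist_L1 g M \<ge> 1"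
    using dir1 dir2 by blast
  moreover have "\<forall>i<m. hval \<psi> (z i) = w i" using \<psi>w by (simp add: hval_def)
  ultimately show ?thesis by (simp add: g_def s_def M_def O1_def \<psi>_def)
qed

end
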